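(* Let $T\in\mathcal M$ be a (bounded) $R$-diagonal operator, let $\lambda\in\mathbb C\setminus\{0\}$ and $\varepsilon>0$. Let $\delta=\delta(\lambda,\varepsilon)$ be determined by the operator-valued subordination function $\Omega_2$ through $\Omega_2(i\varepsilon I_2)=i\delta I_2$. Then $i\,\delta(\lambda,\varepsilon)=\omega_2(i\varepsilon)$, where $\omega_2$ is the scalar subordination function such that $G_{\tilde\mu_{|T-\lambda\mathbf 1|}}(z)=G_\nu(\omega_2(z))$ with $\nu=\frac12(\delta_{|\lambda|}+\delta_{-|\lambda|})$. In particular $\delta(\lambda,\varepsilon)>0$. Moreover, $$\delta(\lambda,\varepsilon)=\operatorname{Im}\omega_2(i\varepsilon)=\frac{|\lambda|^2}{s(|\lambda|,\varepsilon)-\varepsilon}.$$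
   Context: $\mathcal M$ is a finite von Neumann algebra with a faithful normal tracial state $\tau$. $T\in\mathcal M$ is $R$-diagonal if it has the same $*$-distribution as $UH$ with $U$ a Haar unitary and $H\ge0$, $*$-free from $U$, in some von Neumann algebra with faithful normal tracial state. Operator-valued side: let $\mathcal D\subset M_2(\mathbb C)\subset M_2(\mathcal M)$ be the diagonal scalar matrices, with conditional expectation $\mathbb E_{\mathcal D}[(a_{ij})]=\mathrm{diag}(\tau(a_{11}),\tau(a_{22}))$, and let $\mathbb E_{M_2(\mathbb C)}[(a_{ij})]=(\tau(a_{ij}))$. Put $X=\begin{bmatrix}0 & \lambda \\ \overline\lambda & 0\end{bmatrix}$; the algebra generated by $\mathcal D$ and $X$ is $M_2(\mathbb C)$ (for $\lambda\neq0$). $T$ being $R$-diagonal is equivalent to $\begin{bmatrix}0 & T \\ T^* & 0\end{bmatrix}$ and $M_2(\mathbb C)$ being free with amalgamation over $\mathcal D$. Hence there is a $\mathcal D$-valued subordination function $\Omega_2$ such that $$\mathbb E_{M_2(\mathbb C)}\left[\left(\begin{bmatrix}i\varepsilon & \lambda \\ \overline\lambda & i\varepsilon\end{bmatrix}-\begin{bmatrix}0 & T \\ T^* & 0\end{bmatrix}\right)^{-1}\right]=\left(\Omega_2\left(\begin{bmatrix}i\varepsilon & 0 \\ 0 & i\varepsilon\end{bmatrix}\right)-X\right)^{-1},$$ and, by traciality of $\tau$, $\Omega_2(i\varepsilon I_2)$ has equal diagonal entries, denoted $i\delta$ with $\delta=\delta(\lambda,\varepsilon)$. Scalar side: for a probability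 measure $\sigma$ on $\mathbb R$, $G_\sigma(z)=\int\frac{d\sigma(x)}{z-x}$, $F_\sigma=1/G_\sigma$ on the upper half-plane $\mathbb C^+$, and $\tilde\sigma(B)=\frac12(\sigma(B)+\sigma(-B))$. For an operator $x$, $\mu_{|x|}$ is the spectral distribution of $|x|=(x^*x)^{1/2}$ with respect to $\tau$. Put $\mu=\tilde\mu_{|T|}$, $\nu=\frac12(\delta_{|\lambda|}+\delta_{-|\lambda|})$ (here $\delta_x$ denotes the Dirac mass at $x$); it is known that $\tilde\mu_{|T-\lambda\mathbf 1|}=\mu\boxplus\nu$ (free additive convolution). $\omega_1,\omega_2:\mathbb C^+\to\mathbb C^+$ are the analytic subordination functions: $F_\mu(\omega_1(z))=F_\nu(\omega_2(z))=F_{\mu\boxplus\nu}(z)$ and $\omega_1(z)+\omega_2(z)=z+F_{\mu\boxplus\nu}(z)$. For $t>0$, $\omega_1(it)$ is purely imaginary and $s(|\lambda|,t):=\operatorname{Im}\omega_1(it)>t$.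
   Formalization: The equation defining Ω₂ is taken with (Ω₂(b)+X)^{-1} on the right instead of (Ω₂(b)−X)^{-1}: with the printed sign no diagonal Ω₂ exists for λ≠0 (for T=0 it would force Ω₂(b)=b+2X). *)

theory Defs
  imports "HOL-Probability.Probability" "HOL-Complex_Analysis.Complex_Analysis"
begin

section \<open>Bounded operators on a complex Hilbert space\<close>

text \<open>The inner product is linear in the first argument. The zero space carries no state and is
  excluded, so that the bounded operators form a ring with \<open>0 \<noteq> 1\<close>.\<close>

class chilbert_space = banach +
  fixes scaleC :: "complex \<Rightarrow> 'a \<Rightarrow> 'a"  (infixr \<open>*\<^sub>C\<close> 75)
    and cinner :: "'a \<Rightarrow> 'a \<Rightarrow> complex"
  assumes scaleC_add_right: "c *\<^sub>C (x + y) = c *\<^sub>C x + c *\<^sub>C y"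
    and scaleC_add_left: "(c + d) *\<^sub>C x = c *\<^sub>C x + d *\<^sub>C x"
    and scaleC_scaleC: "c *\<^sub>C d *\<^sub>C x = (c * d) *\<^sub>C x"
    and scaleC_of_real: "complex_of_real r *\<^sub>C x = scaleR r x"
    and cinner_add_left: "cinner (x + y) z = cinner x z + cinner y z"
    and cinner_scaleC_left: "cinner (c *\<^sub>C x) y = c * cinner x y"
    and cinner_commute: "cinner x y = cnj (cinner y x)"
    and cinner_self: "cinner x x = complex_of_real ((norm x)\<^sup>2)"
    and nontrivial: "\<exists>x. x \<noteq> 0"
begin

lemma norm_scaleC: "norm (c *\<^sub>C x) = cmod c * norm x"
proof -
  have "complex_of_real ((norm (c *\<^sub>C x))\<^sup>2) = c * cnj c * cinner x x"
    by (metis cinner_self cinner_scaleC_left cinner_commute complex_cnj_mult mult.assoc)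
  also have "\<dots> = complex_of_real ((cmod c * norm x)\<^sup>2)"
    by (simp only: cinner_self complex_norm_square[symmetric] of_real_mult[symmetric]
        power_mult_distrib of_real_power[symmetric])
  finally have "(norm (c *\<^sub>C x))\<^sup>2 = (cmod c * norm x)\<^sup>2"
    using of_real_eq_iff by blast
  then show ?thesis
    by (simp add: power2_eq_iff_nonneg)
qed

end

definition bounded_clinear :: "('h::chilbert_space \<Rightarrow> 'h) \<Rightarrow> bool" where
  "bounded_clinear f \<longleftrightarrow> bounded_linear f \<and> (\<forall>c x. f (c *\<^sub>C x) = c *\<^sub>C f x)"

lemma bounded_clinear_scaleC: "bounded_clinear (\<lambda>x::'h::chilbert_space. c *\<^sub>C x)"
proof -
  have "bounded_linear (\<lambda>x::'h. c *\<^sub>C x)"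
  proof (rule bounded_linear_intro[where K = "cmod c"])
    fix r and x :: 'h
    show "c *\<^sub>C (r *\<^sub>R x) = r *\<^sub>R (c *\<^sub>C x)"
      by (metis scaleC_of_real scaleC_scaleC mult.commute)
  qed (simp_all add: scaleC_add_right norm_scaleC mult.commute)
  then show ?thesis
    unfolding bounded_clinear_def by (simp add: scaleC_scaleC mult.commute)
qed

lemma bounded_clinear_0: "bounded_clinear (\<lambda>x::'h::chilbert_space. 0)"
  unfolding bounded_clinear_def by (metis bounded_linear_zero scaleC_of_real scaleR_zero_right
      scaleC_scaleC scaleC_add_right add_cancel_left_right)

lemma bounded_clinear_minus:
  assumes "bounded_clinear (f :: 'h::chilbert_space \<Rightarrow> 'h)"
  shows "bounded_clinear (\<lambda>x. - f x)"
proof -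
  have "- (c *\<^sub>C y) = c *\<^sub>C (- y)" for c and y :: 'h
    by (metis scaleC_of_real scaleC_scaleC mult.commute scaleR_minus1_left)
  then show ?thesis
    using assms by (simp add: bounded_clinear_def bounded_linear_minus)
qed

lemma bounded_clinear_add:
  "bounded_clinear f \<Longrightarrow> bounded_clinear g \<Longrightarrow> bounded_clinear (\<lambda>x. f x + g x)"
  by (simp add: bounded_clinear_def bounded_linear_add scaleC_add_right)

lemma bounded_clinear_diff:
  assumes "bounded_clinear (f :: 'h::chilbert_space \<Rightarrow> 'h)" "bounded_clinear g"
  shows "bounded_clinear (\<lambda>x. f x - g x)"
  using bounded_clinear_add[OF assms(1) bounded_clinear_minus[OF assms(2)]] by simp

lemma bounded_clinear_compose:
  "bounded_clinear f \<Longrightarrow> bounded_clinear g \<Longrightarrow> bounded_clinear (\<lambda>x. f (g x))"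
  by (simp add: bounded_clinear_def bounded_linear_compose)

lemma bounded_clinear_ident: "bounded_clinear (\<lambda>x. x)"
  by (simp add: bounded_clinear_def bounded_linear_ident)

typedef (overloaded) ('h::chilbert_space) bop = "{f :: 'h \<Rightarrow> 'h. bounded_clinear f}"
  morphisms bop_apply Bop
  using bounded_clinear_0 by blast

setup_lifting type_definition_bop

instantiation bop :: (chilbert_space) ring_1
begin

lift_definition zero_bop :: "'a bop" is "\<lambda>x. 0" by (rule bounded_clinear_0)
lift_definition one_bop :: "'a bop" is "\<lambda>x. x" by (rule bounded_clinear_ident)
lift_definition plus_bop :: "'a bop \<Rightarrow> 'a bop \<Rightarrow> 'a bop" is "\<lambda>f g x. f x + g x"
  by (rule bounded_clinear_add)
lift_definition minus_bop :: "'a bop \<Rightarrow> 'a bop \<Rightarrow> 'a bop" is "\<lambda>f g x. f x - g x"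
  by (rule bounded_clinear_diff)
lift_definition uminus_bop :: "'a bop \<Rightarrow> 'a bop" is "\<lambda>f x. - f x"
  by (rule bounded_clinear_minus)
lift_definition times_bop :: "'a bop \<Rightarrow> 'a bop \<Rightarrow> 'a bop" is "\<lambda>f g x. f (g x)"
  by (rule bounded_clinear_compose)

instance
proof
  show "(0::'a bop) \<noteq> 1"
  proof transfer
    show "(\<lambda>x::'a. 0) \<noteq> (\<lambda>x. x)"
      using nontrivial[where 'a = 'a] by metis
  qed
  fix a b c :: "'a bop"
  show "a * (b + c) = a * b + a * c"
    by transfer (auto simp: bounded_clinear_def linear_simps)
qed (transfer; simp add: fun_eq_iff algebra_simps)+

end

lift_definition scalar :: "complex \<Rightarrow> ('h::chilbert_space) bop" is "\<lambda>c x. c *\<^sub>C x"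
  by (rule bounded_clinear_scaleC)

definition is_adjoint :: "('h::chilbert_space) bop \<Rightarrow> 'h bop \<Rightarrow> bool" where
  "is_adjoint a b \<longleftrightarrow> (\<forall>x y. cinner (bop_apply a x) y = cinner x (bop_apply b y))"

definition adj :: "('h::chilbert_space) bop \<Rightarrow> 'h bop" where
  "adj a = (THE b. is_adjoint a b)"

text \<open>On a complex Hilbert space positivity of the quadratic form entails self-adjointness.\<close>

definition positive_op :: "('h::chilbert_space) bop \<Rightarrow> bool" where
  "positive_op a \<longleftrightarrow>
     (\<forall>x. cinner (bop_apply a x) x \<in> \<real> \<and> 0 \<le> Re (cinner (bop_apply a x) x))"

definition op_le :: "('h::chilbert_space) bop \<Rightarrow> 'h bop \<Rightarrow> bool" where
  "op_le a b \<longleftrightarrow> positive_op (b - a)"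

section \<open>Von Neumann algebras with a faithful normal tracial state\<close>

definition commutant :: "('h::chilbert_space) bop set \<Rightarrow> 'h bop set" where
  "commutant S = {b. \<forall>a\<in>S. a * b = b * a}"

definition von_neumann_algebra :: "('h::chilbert_space) bop set \<Rightarrow> bool" where
  "von_neumann_algebra M \<longleftrightarrow>
     (\<forall>a\<in>M. \<exists>b\<in>M. is_adjoint a b) \<and> commutant (commutant M) = M"

definition state_on :: "('h::chilbert_space) bop set \<Rightarrow> ('h bop \<Rightarrow> complex) \<Rightarrow> bool" where
  "state_on M \<tau> \<longleftrightarrow>
     (\<forall>a\<in>M. \<forall>b\<in>M. \<tau> (a + b) = \<tau> a + \<tau> b) \<and>
     (\<forall>c. \<forall>a\<in>M. \<tau> (scalar c * a) = c * \<tau> a) \<and>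
     (\<forall>a\<in>M. \<tau> (adj a * a) \<in> \<real> \<and> 0 \<le> Re (\<tau> (adj a * a))) \<and>
     \<tau> 1 = 1"

text \<open>Normality: \<open>\<tau>\<close> preserves the least upper bound \<open>s\<close> of every bounded, upward directed
  family \<open>D\<close> of positive elements.\<close>

definition normal_on :: "('h::chilbert_space) bop set \<Rightarrow> ('h bop \<Rightarrow> complex) \<Rightarrow> bool" where
  "normal_on M \<tau> \<longleftrightarrow>
     (\<forall>D s. D \<noteq> {} \<and> D \<subseteq> M \<and> (\<forall>a\<in>D. positive_op a) \<and>
        (\<forall>a\<in>D. \<forall>b\<in>D. \<exists>c\<in>D. op_le a c \<and> op_le b c) \<and>
        s \<in> M \<and> (\<forall>a\<in>D. op_le a s) \<and> (\<forall>u\<in>M. (\<forall>a\<in>D. op_le a u) \<longrightarrow> op_le s u)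
        \<longrightarrow> Re (\<tau> s) = (SUP a\<in>D. Re (\<tau> a)))"

definition tracial_vn_algebra :: "('h::chilbert_space) bop set \<Rightarrow> ('h bop \<Rightarrow> complex) \<Rightarrow> bool" where
  "tracial_vn_algebra M \<tau> \<longleftrightarrow>
     von_neumann_algebra M \<and> state_on M \<tau> \<and> normal_on M \<tau> \<and>
     (\<forall>a\<in>M. \<tau> (adj a * a) = 0 \<longrightarrow> a = 0) \<and>
     (\<forall>a\<in>M. \<forall>b\<in>M. \<tau> (a * b) = \<tau> (b * a))"

section \<open>Freeness, distributions and R-diagonal operators\<close>

inductive_set star_algebra :: "('h::chilbert_space) bop set \<Rightarrow> 'h bop set" for S where
  base: "a \<in> S \<Longrightarrow> a \<in> star_algebra S"
| scal: "scalar c \<in> star_algebra S"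
| add: "a \<in> star_algebra S \<Longrightarrow> b \<in> star_algebra S \<Longrightarrow> a + b \<in> star_algebra S"
| mult: "a \<in> star_algebra S \<Longrightarrow> b \<in> star_algebra S \<Longrightarrow> a * b \<in> star_algebra S"
| adj: "a \<in> star_algebra S \<Longrightarrow> adj a \<in> star_algebra S"

text \<open>Two elements are *-free when every nonempty product of centred elements, taken alternately
  from the two generated unital *-algebras, is centred. The list \<open>js\<close> records the algebra
  each factor comes from.\<close>

definition star_free ::
    "(('h::chilbert_space) bop \<Rightarrow> complex) \<Rightarrow> 'h bop \<Rightarrow> 'h bop \<Rightarrow> bool" where
  "star_free \<tau> x y \<longleftrightarrow>
     (\<forall>(js::bool list) as. js \<noteq> [] \<and> length as = length js \<and> distinct_adj js \<and>
        (\<forall>k<length js. as ! k \<in> star_algebra {if js ! k then x else y} \<and> \<tau> (as ! k) = 0)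
        \<longrightarrow> \<tau> (prod_list as) = 0)"

definition star_word :: "('h::chilbert_space) bop \<Rightarrow> bool list \<Rightarrow> 'h bop" where
  "star_word x w = prod_list (map (\<lambda>s. if s then adj x else x) w)"

definition same_star_distribution ::
    "(('h::chilbert_space) bop \<Rightarrow> complex) \<Rightarrow> 'h bop \<Rightarrow>
     (('k::chilbert_space) bop \<Rightarrow> complex) \<Rightarrow> 'k bop \<Rightarrow> bool" where
  "same_star_distribution \<tau> x \<phi> y \<longleftrightarrow> (\<forall>w. \<tau> (star_word x w) = \<phi> (star_word y w))"

definition haar_unitary :: "(('h::chilbert_space) bop \<Rightarrow> complex) \<Rightarrow> 'h bop \<Rightarrow> bool" where
  "haar_unitary \<tau> u \<longleftrightarrow> adj u * u = 1 \<and> u * adj u = 1 \<and>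
     (\<forall>n>0. \<tau> (u ^ n) = 0 \<and> \<tau> (adj u ^ n) = 0)"

text \<open>``In some von Neumann algebra'' is an existential over Hilbert spaces, which HOL cannot
  quantify inside a formula. The Hilbert space \<open>'k\<close> is therefore a type parameter. As the predicate
  is used as a hypothesis, a type variable \<open>'k\<close> of the theorem is universally quantified outside
  the implication, which is the required existential in the premise. The same applies to
  \<open>free_additive_convolution\<close> below.\<close>

definition R_diagonal ::
    "('k::chilbert_space) itself \<Rightarrow> (('h::chilbert_space) bop \<Rightarrow> complex) \<Rightarrow> 'h bop \<Rightarrow> bool" where
  "R_diagonal _ \<tau> T \<longleftrightarrow>
     (\<exists>(N :: 'k bop set) \<phi> U H. tracial_vn_algebra N \<phi> \<and> U \<in> N \<and> H \<in> N \<and>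
        haar_unitary \<phi> U \<and> positive_op H \<and> star_free \<phi> U H \<and>
        same_star_distribution \<tau> T \<phi> (U * H))"

text \<open>The spectral distribution of a bounded self-adjoint \<open>a\<close> is the unique compactly supported
  probability measure with the moments of \<open>a\<close>.\<close>

definition spectral_distribution ::
    "(('h::chilbert_space) bop \<Rightarrow> complex) \<Rightarrow> 'h bop \<Rightarrow> real measure \<Rightarrow> bool" where
  "spectral_distribution \<tau> a \<sigma> \<longleftrightarrow>
     is_adjoint a a \<and> real_distribution \<sigma> \<and> (\<exists>r. measure \<sigma> {-r..r} = 1) \<and>
     (\<forall>n. \<tau> (a ^ n) = complex_of_real (\<integral>x. x ^ n \<partial>\<sigma>))"

text \<open>\<open>a\<close> is the modulus \<open>|x| = (x\<^sup>* x)\<^sup>1\<^sup>/\<^sup>2\<close>, i.e. the unique positive square root of \<open>x\<^sup>* x\<close>.\<close>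

definition is_modulus :: "('h::chilbert_space) bop \<Rightarrow> 'h bop \<Rightarrow> bool" where
  "is_modulus x a \<longleftrightarrow> positive_op a \<and> a * a = adj x * x"

definition modulus_distribution ::
    "(('h::chilbert_space) bop \<Rightarrow> complex) \<Rightarrow> 'h bop \<Rightarrow> real measure \<Rightarrow> bool" where
  "modulus_distribution \<tau> x \<sigma> \<longleftrightarrow> (\<exists>a. is_modulus x a \<and> spectral_distribution \<tau> a \<sigma>)"

section \<open>Scalar subordination\<close>

definition half_sum :: "real measure \<Rightarrow> real measure \<Rightarrow> real measure" where
  "half_sum \<sigma>\<^sub>1 \<sigma>\<^sub>2 = measure_of UNIV (sets borel) (\<lambda>B. (emeasure \<sigma>\<^sub>1 B + emeasure \<sigma>\<^sub>2 B) / 2)"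

definition symmetrization :: "real measure \<Rightarrow> real measure" where
  "symmetrization \<sigma> = half_sum \<sigma> (distr \<sigma> borel uminus)"

definition two_point :: "real \<Rightarrow> real measure" where
  "two_point r = half_sum (return borel r) (return borel (- r))"

definition upper_half_plane :: "complex set" where
  "upper_half_plane = {z. 0 < Im z}"

definition cauchy_transform :: "real measure \<Rightarrow> complex \<Rightarrow> complex" where
  "cauchy_transform \<sigma> z = (\<integral>x. 1 / (z - complex_of_real x) \<partial>\<sigma>)"

definition F_transform :: "real measure \<Rightarrow> complex \<Rightarrow> complex" where
  "F_transform \<sigma> z = 1 / cauchy_transform \<sigma> z"

text \<open>\<open>\<sigma> = \<mu> \<boxplus> \<nu>\<close> for compactly supported measures: the distribution of the sum of
  free self-adjoint elements with distributions \<open>\<mu>\<close> and \<open>\<nu>\<close>.\<close>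

definition free_additive_convolution ::
    "('k::chilbert_space) itself \<Rightarrow> real measure \<Rightarrow> real measure \<Rightarrow> real measure \<Rightarrow> bool" where
  "free_additive_convolution _ \<mu> \<nu> \<sigma> \<longleftrightarrow>
     (\<exists>(N :: 'k bop set) \<phi> a b. tracial_vn_algebra N \<phi> \<and> a \<in> N \<and> b \<in> N \<and> star_free \<phi> a b \<and>
        spectral_distribution \<phi> a \<mu> \<and> spectral_distribution \<phi> b \<nu> \<and>
        spectral_distribution \<phi> (a + b) \<sigma>)"

definition scalar_subordination ::
    "real measure \<Rightarrow> real measure \<Rightarrow> real measure \<Rightarrow>
     (complex \<Rightarrow> complex) \<Rightarrow> (complex \<Rightarrow> complex) \<Rightarrow> bool" where
  "scalar_subordination \<mu> \<nu> \<sigma> \<omega>\<^sub>1 \<omega>\<^sub>2 \<longleftrightarrow>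
     \<omega>\<^sub>1 holomorphic_on upper_half_plane \<and> \<omega>\<^sub>2 holomorphic_on upper_half_plane \<and>
     (\<forall>z\<in>upper_half_plane.
        \<omega>\<^sub>1 z \<in> upper_half_plane \<and> \<omega>\<^sub>2 z \<in> upper_half_plane \<and>
        F_transform \<mu> (\<omega>\<^sub>1 z) = F_transform \<sigma> z \<and> F_transform \<nu> (\<omega>\<^sub>2 z) = F_transform \<sigma> z \<and>
        \<omega>\<^sub>1 z + \<omega>\<^sub>2 z = z + F_transform \<sigma> z)"

section \<open>Operator-valued subordination over the diagonal matrices\<close>

definition mat2 :: "'a \<Rightarrow> 'a \<Rightarrow> 'a \<Rightarrow> 'a \<Rightarrow> 'a::zero ^ 2 ^ 2" where
  "mat2 a b c d = vector [vector [a, b], vector [c, d]]"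

text \<open>The entrywise application \<open>map_matrix scalar\<close> is the inclusion of the scalar
  matrices into the matrices over the algebra, and \<open>map_matrix \<tau>\<close> is the conditional
  expectation onto the scalar matrices.\<close>

definition diag_upper_half_plane :: "(complex ^ 2 ^ 2) set" where
  "diag_upper_half_plane =
     {b. b $ 1 $ 2 = 0 \<and> b $ 2 $ 1 = 0 \<and> 0 < Im (b $ 1 $ 1) \<and> 0 < Im (b $ 2 $ 2)}"

definition diag_analytic :: "(complex ^ 2 ^ 2 \<Rightarrow> complex ^ 2 ^ 2) \<Rightarrow> bool" where
  "diag_analytic \<Omega> \<longleftrightarrow>
     (\<forall>b\<in>diag_upper_half_plane. \<exists>L. (\<Omega> has_derivative L) (at b within diag_upper_half_plane) \<and>
        (\<forall>c A. L (mat c ** A) = mat c ** L A))"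

text \<open>With \<open>X = mat2 0 lam (cnj lam) 0\<close>, the matrix being inverted on the left is
  \<open>b - (mat2 0 T (adj T) 0 + (- X))\<close>. Subordination with respect to the summand \<open>- X\<close>
  therefore gives \<open>\<Omega> b - (- X) = \<Omega> b + X\<close> on the right. (With \<open>\<Omega> b - X\<close> the identity would already
  fail for \<open>T = 0\<close>, where it would force \<open>\<Omega> b = b + 2 X\<close>, which is not diagonal.)\<close>

definition operator_subordination ::
    "(('h::chilbert_space) bop \<Rightarrow> complex) \<Rightarrow> 'h bop \<Rightarrow> complex \<Rightarrow>
     (complex ^ 2 ^ 2 \<Rightarrow> complex ^ 2 ^ 2) \<Rightarrow> bool" where
  "operator_subordination \<tau> T lam \<Omega> \<longleftrightarrow>
     diag_analytic \<Omega> \<and>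
     (\<forall>b\<in>diag_upper_half_plane.
        \<Omega> b \<in> diag_upper_half_plane \<and>
        map_matrix \<tau> (matrix_inv
          (map_matrix scalar (b + mat2 0 lam (cnj lam) 0) - mat2 0 T (adj T) 0))
        = matrix_inv (\<Omega> b + mat2 0 lam (cnj lam) 0))"

end

theory Submission
  imports Defs
begin

text \<open>Because \<open>T\<close> has the *-distribution of \<open>U H\<close>, the hermitization of \<open>T - \<lambda>\<close> is, up to conjugation by
  \<open>diag(U, 1)\<close>, the sum of \<open>A = [[0, H], [H, 0]]\<close> and \<open>B = [[0, -\<lambda> U\<^sup>*], [-cnj \<lambda> U, 0]]\<close>. Freeness of \<open>U\<close>
  and \<open>H\<close> kills the trace of every product \<open>p\<^sub>0(A) B p\<^sub>1(A) B \<dots> p\<^sub>n(A)\<close> whose interior factors are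
  centred, and \<open>B\<^sup>2 = |\<lambda>|\<^sup>2\<close>; the same holds for a free pair realizing \<open>\<mu> \<boxplus> \<nu>\<close>, and the two properties
  determine all moments of the sum, so the symmetrized law of \<open>|T - \<lambda>|\<close> is \<open>\<mu> \<boxplus> \<nu>\<close>.

  The diagonal entry \<open>w(z)\<close> of \<open>\<Omega>\<^sub>2(z I\<^sub>2)\<close> and \<open>\<omega>\<^sub>2(z)\<close> then both solve \<open>G\<^sub>\<nu>(w) = G(z)\<close>, which forces
  \<open>w = \<omega>\<^sub>2\<close> or \<open>w \<omega>\<^sub>2 = -|\<lambda>|\<^sup>2\<close>. High on the imaginary axis \<open>|\<omega>\<^sub>2(iy)| \<ge> y\<close>, while the off-diagonal
  entry of the resolvent is \<open>O(y\<^sup>-\<^sup>2)\<close>, which excludes the second alternative; the identity theorem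
  does the rest. Reflecting \<open>\<omega>\<^sub>2\<close> in the imaginary axis, the same dichotomy shows that
  \<open>\<omega>\<^sub>2(i\<epsilon>)\<close> is purely imaginary.\<close>

section \<open>Bounded operators and tracial states\<close>

lemma cinner_add_right: "cinner x (y + z) = cinner x y + cinner (x::'h::chilbert_space) z"
  by (metis cinner_add_left cinner_commute complex_cnj_add)

lemma cinner_scaleC_right: "cinner x (c *\<^sub>C y) = cnj c * cinner (x::'h::chilbert_space) y"
  by (metis cinner_scaleC_left cinner_commute complex_cnj_mult)

lemma cinner_diff_left: "cinner (x - y) z = cinner x z - cinner (y::'h::chilbert_space) z"
  using cinner_add_left[of "x - y" y z] by simp

lemma cinner_diff_right: "cinner x (y - z) = cinner x y - cinner (x::'h::chilbert_space) z"
  using cinner_add_right[of x "y - z" z] by simp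

lemma cinner_self_eq_0: "cinner x x = 0 \<Longrightarrow> x = (0::'h::chilbert_space)"
  by (simp add: cinner_self)

lemma bop_eqI: "(\<And>x. bop_apply a x = bop_apply b x) \<Longrightarrow> a = b"
  by (metis bop_apply_inject ext)

lemma scalar_add: "scalar (c + d) = scalar c + scalar d"
  by transfer (simp add: scaleC_add_left fun_eq_iff)

lemma scalar_mult: "scalar (c * d) = scalar c * scalar d"
  by transfer (simp add: scaleC_scaleC fun_eq_iff)

lemma scalar_1: "scalar 1 = 1"
  by transfer (metis scaleC_of_real of_real_1 scaleR_one)

lemma scalar_0: "scalar 0 = 0"
  using scalar_add[of 0 0] by simp

lemma scalar_central: "scalar c * x = x * scalar c"
  by transfer (simp add: bounded_clinear_def)

lemma scalar_minus: "scalar (- c) = - scalar c"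
  using scalar_add[of c "- c"] by (simp add: scalar_0 add_eq_0_iff)

lemma is_adjoint_unique:
  assumes "is_adjoint a b" "is_adjoint a c"
  shows "b = c"
proof (rule bop_eqI)
  fix x
  have "cinner y (bop_apply b x - bop_apply c x) = 0" for y
    using assms unfolding is_adjoint_def by (metis cinner_diff_right right_minus_eq)
  then show "bop_apply b x = bop_apply c x"
    using cinner_self_eq_0 right_minus_eq by blast
qed

lemma adj_eqI: "is_adjoint a b \<Longrightarrow> adj a = b"
  unfolding adj_def using is_adjoint_unique by blast

lemma is_adjoint_sym: "is_adjoint a b \<Longrightarrow> is_adjoint b a"
  unfolding is_adjoint_def by (metis cinner_commute)

lemma is_adjoint_add: "is_adjoint a b \<Longrightarrow> is_adjoint c d \<Longrightarrow> is_adjoint (a + c) (b + d)"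
  by (simp add: is_adjoint_def plus_bop.rep_eq cinner_add_left cinner_add_right)

lemma is_adjoint_diff: "is_adjoint a b \<Longrightarrow> is_adjoint c d \<Longrightarrow> is_adjoint (a - c) (b - d)"
  by (simp add: is_adjoint_def minus_bop.rep_eq cinner_diff_left cinner_diff_right)

lemma is_adjoint_mult: "is_adjoint a b \<Longrightarrow> is_adjoint c d \<Longrightarrow> is_adjoint (a * c) (d * b)"
  by (simp add: is_adjoint_def times_bop.rep_eq)

lemma is_adjoint_scalar: "is_adjoint (scalar c) (scalar (cnj c))"
  by (simp add: is_adjoint_def scalar.rep_eq cinner_scaleC_left cinner_scaleC_right)

lemma is_adjoint_1: "is_adjoint 1 1"
  by (simp add: is_adjoint_def one_bop.rep_eq)

lemma is_adjoint_power: "is_adjoint a b \<Longrightarrow> is_adjoint (a ^ n) (b ^ n)"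
proof (induct n)
  case (Suc n)
  then show ?case using is_adjoint_mult[of a b "a ^ n" "b ^ n"]
    by (simp add: power_commutes)
qed (simp add: is_adjoint_1)

lemma quadratic_form_zero:
  assumes "\<And>x. cinner (bop_apply d x) x = 0"
  shows "d = 0"
proof (rule bop_eqI)
  fix x
  have add: "bop_apply d (u + v) = bop_apply d u + bop_apply d v" for u v
    using bop_apply[of d] unfolding mem_Collect_eq bounded_clinear_def by (simp add: linear_simps)
  have scl: "bop_apply d (c *\<^sub>C v) = c *\<^sub>C bop_apply d v" for c v
    using bop_apply[of d] unfolding mem_Collect_eq bounded_clinear_def by simp
  have sum: "cinner (bop_apply d u) v + cinner (bop_apply d v) u = 0" for u v
    using assms[of "u + v"] assms[of u] assms[of v]
    by (simp add: add cinner_add_left cinner_add_right add.commute)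
  have "cinner (bop_apply d u) v = 0" for u v
    using sum[of u v] sum[of u "\<i> *\<^sub>C v"]
    by (simp add: scl cinner_scaleC_left cinner_scaleC_right algebra_simps add_eq_0_iff)
  then show "bop_apply d x = bop_apply 0 x"
    using cinner_self_eq_0 zero_bop.rep_eq by metis
qed

lemma positive_op_self_adjoint:
  assumes "positive_op a" "is_adjoint a b"
  shows "is_adjoint a a"
proof -
  have "cinner (bop_apply (a - b) x) x = 0" for x
  proof -
    have "cinner (bop_apply b x) x = cnj (cinner (bop_apply a x) x)"
      using assms(2) unfolding is_adjoint_def by (metis cinner_commute)
    also have "\<dots> = cinner (bop_apply a x) x"
      using assms(1) unfolding positive_op_def by (simp add: Reals_cnj_iff)
    finally show ?thesis
      by (simp add: minus_bop.rep_eq cinner_diff_left)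
  qed
  then have "a = b"
    using quadratic_form_zero by fastforce
  then show ?thesis using assms by simp
qed

lemma bop_one_minus_invertible:
  fixes K :: "('h::chilbert_space) bop"
  assumes c: "0 \<le> c" "c < 1" and K: "\<And>x. norm (bop_apply K x) \<le> c * norm x"
  shows "\<exists>R. (1 - K) * R = 1 \<and> R * (1 - K) = 1"
proof -
  have bl: "bounded_clinear (bop_apply K)" using bop_apply by blast
  have add: "bop_apply K (u + v) = bop_apply K u + bop_apply K v"
    and diff: "bop_apply K (u - v) = bop_apply K u - bop_apply K v"
    and scl: "bop_apply K (d *\<^sub>C v) = d *\<^sub>C bop_apply K v" for u v d
    using bl unfolding bounded_clinear_def by (simp_all add: linear_simps)
  have sc_diff: "d *\<^sub>C (u - v) = d *\<^sub>C u - d *\<^sub>C v" for d and u v :: 'h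
    using scaleC_add_right[of d "u - v" v] by simp
  have uniq: "x = y" if "x - bop_apply K x = y - bop_apply K y" for x y
  proof -
    have "x - y = bop_apply K (x - y)" using that by (simp add: diff algebra_simps)
    then have "norm (x - y) \<le> c * norm (x - y)" using K[of "x - y"] by simp
    then have "(1 - c) * norm (x - y) \<le> 0" by (simp add: algebra_simps)
    then show ?thesis using c by (simp add: mult_le_0_iff)
  qed
  have "\<exists>x. x - bop_apply K x = y" for y
  proof -
    have "\<exists>!x. y + bop_apply K x = x"
    proof (rule banach_fix_type)
      show "\<forall>x. \<forall>z. dist (y + bop_apply K x) (y + bop_apply K z) \<le> c * dist x z"
        using K by (auto simp: dist_norm diff[symmetric])
    qed (use c in auto)
    then obtain x where "y + bop_apply K x = x" by blast
    then have "x - bop_apply K x = y" by (simp add: algebra_simps)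
    then show ?thesis by blast
  qed
  then obtain r where r: "\<And>y. r y - bop_apply K (r y) = y" by metis
  have r_scl: "r (d *\<^sub>C x) = d *\<^sub>C r x" for d x
    by (rule uniq) (simp only: r scl sc_diff[symmetric])
  have "bounded_linear r"
  proof (rule bounded_linear_intro[where K = "1 / (1 - c)"])
    show "r (x + y) = r x + r y" for x y
    proof (rule uniq)
      have "r x + r y - bop_apply K (r x + r y)
          = (r x - bop_apply K (r x)) + (r y - bop_apply K (r y))"
        by (simp add: add)
      then show "r (x + y) - bop_apply K (r (x + y)) = r x + r y - bop_apply K (r x + r y)"
        by (simp only: r)
    qed
    show "r (t *\<^sub>R x) = t *\<^sub>R r x" for t x
      unfolding scaleC_of_real[symmetric] by (rule r_scl)
    show "norm (r x) \<le> norm x * (1 / (1 - c))" for x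
    proof -
      have "norm (r x) \<le> norm (r x - bop_apply K (r x)) + norm (bop_apply K (r x))"
        using norm_triangle_ineq[of "r x - bop_apply K (r x)" "bop_apply K (r x)"]
        by (simp only: diff_add_cancel)
      then have "norm (r x) \<le> norm x + norm (bop_apply K (r x))"
        by (simp only: r)
      then have "(1 - c) * norm (r x) \<le> norm x" using K[of "r x"] by (simp add: algebra_simps)
      then show ?thesis using c by (simp add: field_simps)
    qed
  qed
  then have "bounded_clinear r" by (simp add: bounded_clinear_def r_scl)
  then have Ap: "bop_apply (Bop r) = r" by (simp add: Bop_inverse)
  have "(1 - K) * Bop r = 1"
    by (rule bop_eqI) (simp add: times_bop.rep_eq minus_bop.rep_eq one_bop.rep_eq Ap r)
  moreover have "Bop r * (1 - K) = 1"
  proof (rule bop_eqI)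
    show "bop_apply (Bop r * (1 - K)) x = bop_apply 1 x" for x
      unfolding times_bop.rep_eq minus_bop.rep_eq one_bop.rep_eq Ap by (rule uniq) (rule r)
  qed
  ultimately show ?thesis by blast
qed

lemma bop_scalar_plus_invertible:
  fixes P :: "('h::chilbert_space) bop"
  shows "\<exists>Y. \<forall>y>Y. \<exists>R. (scalar (complex_of_real (y\<^sup>2)) + P) * R = 1
    \<and> R * (scalar (complex_of_real (y\<^sup>2)) + P) = 1"
proof -
  have "bounded_linear (bop_apply P)" using bop_apply[of P] by (simp add: bounded_clinear_def)
  then obtain k where k: "k > 0" "\<And>x. norm (bop_apply P x) \<le> norm x * k"
    using bounded_linear.pos_bounded by blast
  have "\<exists>R. (scalar (complex_of_real (y\<^sup>2)) + P) * R = 1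
      \<and> R * (scalar (complex_of_real (y\<^sup>2)) + P) = 1" if y: "y > max 1 (2 * k)" for y
  proof -
    let ?c = "complex_of_real (y\<^sup>2)"
    have y2: "2 * k < y\<^sup>2" and y0: "y > 0"
      using y k by (auto simp: power2_eq_square intro: less_le_trans[of _ "y * 1"])
    have "\<exists>R. (1 - scalar (- 1 / ?c) * P) * R = 1 \<and> R * (1 - scalar (- 1 / ?c) * P) = 1"
    proof (rule bop_one_minus_invertible[of "1/2"])
      fix x
      have "norm (bop_apply (scalar (- 1 / ?c) * P) x) = norm (bop_apply P x) / y\<^sup>2"
        by (simp add: times_bop.rep_eq scalar.rep_eq norm_scaleC norm_divide norm_power)
      also have "\<dots> \<le> (norm x * k) / y\<^sup>2"
        using k by (intro divide_right_mono) auto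
      also have "\<dots> \<le> 1/2 * norm x"
        using y2 y0 mult_left_mono[of "2 * k" "y\<^sup>2" "norm x"] by (simp add: field_simps)
      finally show "norm (bop_apply (scalar (- 1 / ?c) * P) x) \<le> 1/2 * norm x" .
    qed auto
    then obtain R where R: "(1 - scalar (- 1 / ?c) * P) * R = 1" "R * (1 - scalar (- 1 / ?c) * P) = 1"
      by blast
    have c0: "?c \<noteq> 0" using y0 by simp
    have e: "1 - scalar (- 1 / ?c) * P = scalar (1 / ?c) * (scalar ?c + P)"
      using c0 by (simp add: distrib_left scalar_mult[symmetric] scalar_1 scalar_minus)
    have "(scalar ?c + P) * (scalar (1 / ?c) * R) = 1"
      using R(1) unfolding e mult.assoc scalar_central[of "1 / ?c"] .
    moreover have "(scalar (1 / ?c) * R) * (scalar ?c + P) = 1"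
      using R(2) unfolding e by (simp only: scalar_central[of "1 / ?c" R] mult.assoc)
    ultimately show ?thesis by blast
  qed
  then show ?thesis by blast
qed

locale tracial_algebra =
  fixes M :: "('h::chilbert_space) bop set" and \<tau> :: "'h bop \<Rightarrow> complex"
  assumes tracial: "tracial_vn_algebra M \<tau>"
begin

lemma in_M_iff: "a \<in> M \<longleftrightarrow> (\<forall>b\<in>commutant M. b * a = a * b)"
proof -
  have "commutant (commutant M) = M"
    using tracial by (simp add: tracial_vn_algebra_def von_neumann_algebra_def)
  moreover have "a \<in> commutant (commutant M) \<longleftrightarrow> (\<forall>b\<in>commutant M. b * a = a * b)"
    unfolding commutant_def[of "commutant M"] by simp
  ultimately show ?thesis by (simp only:)
qed

lemma scalar_in: "scalar c \<in> M"
  unfolding in_M_iff using scalar_central by metis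

lemma one_in: "1 \<in> M"
  using scalar_in[of 1] by (simp add: scalar_1)

lemma add_in: "a \<in> M \<Longrightarrow> b \<in> M \<Longrightarrow> a + b \<in> M"
  unfolding in_M_iff by (simp add: algebra_simps)

lemma diff_in: "a \<in> M \<Longrightarrow> b \<in> M \<Longrightarrow> a - b \<in> M"
  unfolding in_M_iff by (simp add: algebra_simps)

lemma mult_in: "a \<in> M \<Longrightarrow> b \<in> M \<Longrightarrow> a * b \<in> M"
  unfolding in_M_iff by (metis mult.assoc)

lemma power_in: "a \<in> M \<Longrightarrow> a ^ n \<in> M"
  by (induct n) (auto intro: one_in mult_in)

lemma inverse_in:
  assumes "a \<in> M" "a * r = 1" "r * a = 1"
  shows "r \<in> M"
  unfolding in_M_iff
proof
  fix b assume "b \<in> commutant M"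
  then have "b * a = a * b" using assms(1) by (auto simp: in_M_iff)
  then show "b * r = r * b"
    using assms(2,3) by (metis mult.assoc mult.left_neutral mult.right_neutral)
qed

lemma star_closed: "a \<in> M \<Longrightarrow> \<exists>b\<in>M. is_adjoint a b"
  using tracial by (simp add: tracial_vn_algebra_def von_neumann_algebra_def)

lemma is_adjoint_adj: "a \<in> M \<Longrightarrow> is_adjoint a (adj a)"
  using star_closed adj_eqI by blast

lemma adj_in: "a \<in> M \<Longrightarrow> adj a \<in> M"
  using star_closed adj_eqI by blast

lemma adj_mult: "a \<in> M \<Longrightarrow> b \<in> M \<Longrightarrow> adj (a * b) = adj b * adj a"
  by (simp add: adj_eqI is_adjoint_adj is_adjoint_mult)

lemma adj_adj: "a \<in> M \<Longrightarrow> adj (adj a) = a"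
  by (simp add: adj_eqI is_adjoint_adj is_adjoint_sym)

lemma star_algebra_in: "x \<in> M \<Longrightarrow> a \<in> star_algebra {x} \<Longrightarrow> a \<in> M"
  by (rotate_tac 1, induct rule: star_algebra.induct)
    (auto intro: scalar_in add_in mult_in adj_in)

lemma state: "state_on M \<tau>"
  using tracial by (simp add: tracial_vn_algebra_def)

lemma state_add: "a \<in> M \<Longrightarrow> b \<in> M \<Longrightarrow> \<tau> (a + b) = \<tau> a + \<tau> b"
  using state by (simp add: state_on_def)

lemma state_scalar_mult: "a \<in> M \<Longrightarrow> \<tau> (scalar c * a) = c * \<tau> a"
  using state by (simp add: state_on_def)

lemma state_one: "\<tau> 1 = 1"
  using state by (simp add: state_on_def)

lemma state_positive: "a \<in> M \<Longrightarrow> \<tau> (adj a * a) \<in> \<real> \<and> 0 \<le> Re (\<tau> (adj a * a))"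
  using state by (simp add: state_on_def)

lemma state_faithful: "a \<in> M \<Longrightarrow> \<tau> (adj a * a) = 0 \<Longrightarrow> a = 0"
  using tracial by (simp add: tracial_vn_algebra_def)

lemma state_commute: "a \<in> M \<Longrightarrow> b \<in> M \<Longrightarrow> \<tau> (a * b) = \<tau> (b * a)"
  using tracial by (simp add: tracial_vn_algebra_def)

lemma state_scalar: "\<tau> (scalar c) = c"
  using state_scalar_mult[OF one_in, of c] by (simp add: state_one)

lemma state_uminus: "a \<in> M \<Longrightarrow> \<tau> (- a) = - \<tau> a"
  using state_scalar_mult[of a "- 1"] by (simp add: scalar_minus scalar_1)

lemma state_diff: "a \<in> M \<Longrightarrow> b \<in> M \<Longrightarrow> \<tau> (a - b) = \<tau> a - \<tau> b"
  using state_add[of "a - b" b] by (simp add: diff_in)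

lemma state_power_commute:
  assumes "a \<in> M" "b \<in> M"
  shows "\<tau> ((a * b) ^ n) = \<tau> ((b * a) ^ n)"
proof (cases n)
  case (Suc k)
  have "(a * b) ^ Suc k = a * ((b * a) ^ k * b)" for k
    by (induct k) (simp_all add: mult.assoc)
  moreover have "(b * a) ^ Suc k = ((b * a) ^ k * b) * a" for k
    by (metis mult.assoc power_Suc2)
  ultimately show ?thesis
    using Suc assms state_commute[of a "(b * a) ^ k * b"]
    by (simp add: mult_in power_in del: power_Suc)
qed simp

lemma Cauchy_Schwarz:
  assumes a: "a \<in> M" and b: "b \<in> M"
  shows "(cmod (\<tau> (adj a * b)))\<^sup>2 \<le> Re (\<tau> (adj a * a)) * Re (\<tau> (adj b * b))"
proof -
  let ?t = "\<tau> (adj a * b)"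
  obtain A B where A: "\<tau> (adj a * a) = complex_of_real A" and B: "\<tau> (adj b * b) = complex_of_real B"
    using state_positive[OF a] state_positive[OF b] by (auto elim!: Reals_cases)
  have in_M: "adj a * b \<in> M" "adj b * a \<in> M" "adj a * a \<in> M" "adj b * b \<in> M"
    using a b by (auto intro: mult_in adj_in)
  have expand: "\<tau> (adj (a - scalar c * b) * (a - scalar c * b))
      = \<tau> (adj a * a) - c * ?t - cnj c * \<tau> (adj b * a) + cnj c * c * \<tau> (adj b * b)" for c
  proof -
    have "adj (a - scalar c * b) = adj a - scalar (cnj c) * adj b"
      by (rule adj_eqI, subst scalar_central[of "cnj c"])
        (intro is_adjoint_diff is_adjoint_mult is_adjoint_scalar is_adjoint_adj a b)
    then have "adj (a - scalar c * b) * (a - scalar c * b)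
      = adj a * a - adj a * (scalar c * b) - scalar (cnj c) * (adj b * a)
        + scalar (cnj c) * (adj b * (scalar c * b))"
      by (simp only:) (simp add: algebra_simps)
    also have "adj a * (scalar c * b) = scalar c * (adj a * b)"
      by (metis mult.assoc scalar_central)
    also have "scalar (cnj c) * (adj b * (scalar c * b)) = scalar (cnj c * c) * (adj b * b)"
      by (metis mult.assoc scalar_central scalar_mult)
    finally show ?thesis
      using in_M by (simp add: state_add state_diff state_scalar_mult add_in diff_in mult_in scalar_in)
  qed
  have nonneg: "0 \<le> Re (\<tau> (adj a * a) - c * ?t - cnj c * \<tau> (adj b * a)
      + cnj c * c * \<tau> (adj b * b))"
    and real: "Im (\<tau> (adj a * a) - c * ?t - cnj c * \<tau> (adj b * a)
      + cnj c * c * \<tau> (adj b * b)) = 0" for c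
    using state_positive[of "a - scalar c * b"] a b unfolding expand
    by (auto intro: diff_in mult_in scalar_in simp: complex_is_Real_iff)
  have sym: "\<tau> (adj b * a) = cnj ?t"
    using real[of 1] real[of \<i>] by (simp add: A B complex_eq_iff)
  have quad: "0 \<le> A - 2 * s * (cmod ?t)\<^sup>2 + s\<^sup>2 * (cmod ?t)\<^sup>2 * B" for s
  proof -
    have t: "cnj ?t * ?t = complex_of_real ((cmod ?t)\<^sup>2)" "?t * cnj ?t = complex_of_real ((cmod ?t)\<^sup>2)"
      by (metis complex_norm_square mult.commute)+
    have "\<tau> (adj a * a) - (complex_of_real s * cnj ?t) * ?t - cnj (complex_of_real s * cnj ?t) * cnj ?t
      + cnj (complex_of_real s * cnj ?t) * (complex_of_real s * cnj ?t) * \<tau> (adj b * b)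
      = \<tau> (adj a * a) - complex_of_real s * (cnj ?t * ?t) - complex_of_real s * (?t * cnj ?t)
        + complex_of_real s * complex_of_real s * (?t * cnj ?t) * \<tau> (adj b * b)"
      by (simp add: algebra_simps)
    also have "\<dots> = complex_of_real (A - s * (cmod ?t)\<^sup>2 - s * (cmod ?t)\<^sup>2 + s * s * (cmod ?t)\<^sup>2 * B)"
      unfolding t A B by simp
    finally show ?thesis
      using nonneg[of "complex_of_real s * cnj ?t"] unfolding sym
      by (simp add: power2_eq_square)
  qed
  have "(cmod ?t)\<^sup>2 \<le> A * B"
  proof (cases "B = 0")
    case True
    then have "b = 0" using B b state_faithful by simp
    then show ?thesis using state_scalar[of 0] True by (simp add: scalar_0)
  next
    case False
    then have "B > 0" using state_positive[OF b] B by simp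
    then show ?thesis using quad[of "1 / B"]
      by (simp add: power2_eq_square field_simps)
  qed
  then show ?thesis by (simp add: A B)
qed

end

section \<open>Moments of the sum of a free pair\<close>

definition peval :: "(complex \<Rightarrow> 'r::ring_1) \<Rightarrow> 'r \<Rightarrow> complex poly \<Rightarrow> 'r" where
  "peval s a p = fold_coeffs (\<lambda>c x. s c + a * x) p 0"

locale functional =
  fixes C :: "'r::ring_1 set" and s :: "complex \<Rightarrow> 'r" and \<psi> :: "'r \<Rightarrow> complex"
  assumes s_add: "s (c + d) = s c + s d"
    and s_mult: "s (c * d) = s c * s d"
    and s_one: "s 1 = 1"
    and s_central: "s c * x = x * s c"
    and s_in: "s c \<in> C"
    and add_in: "x \<in> C \<Longrightarrow> y \<in> C \<Longrightarrow> x + y \<in> C"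
    and mult_in: "x \<in> C \<Longrightarrow> y \<in> C \<Longrightarrow> x * y \<in> C"
    and psi_add: "x \<in> C \<Longrightarrow> y \<in> C \<Longrightarrow> \<psi> (x + y) = \<psi> x + \<psi> y"
    and psi_one: "\<psi> 1 = 1"
    and psi_scale: "x \<in> C \<Longrightarrow> \<psi> (s c * x) = c * \<psi> x"
begin

lemma s_zero: "s 0 = 0"
  using s_add[of 0 0] by simp

lemma zero_in: "0 \<in> C"
  using s_in[of 0] by (simp add: s_zero)

lemma one_in: "1 \<in> C"
  using s_in[of 1] by (simp add: s_one)

lemma psi_zero: "\<psi> 0 = 0"
  using psi_add[OF zero_in zero_in] by simp

lemma power_in: "x \<in> C \<Longrightarrow> x ^ n \<in> C"
  by (induct n) (auto intro: one_in mult_in)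

lemma peval_0: "peval s a 0 = 0"
  by (simp add: peval_def)

lemma peval_pCons: "peval s a (pCons c p) = s c + a * peval s a p"
  by (cases "p = 0 \<and> c = 0") (auto simp: peval_def s_zero)

lemma peval_in: "a \<in> C \<Longrightarrow> peval s a p \<in> C"
  by (induct p) (auto simp: peval_0 peval_pCons intro: zero_in s_in add_in mult_in)

lemma peval_add: "peval s a (p + q) = peval s a p + peval s a q"
  by (induct p q rule: poly_induct2) (simp_all add: peval_0 peval_pCons s_add algebra_simps)

lemma peval_smult: "peval s a (smult c p) = s c * peval s a p"
proof (induct p)
  case (pCons d p)
  have "a * (s c * peval s a p) = s c * (a * peval s a p)"
    by (metis mult.assoc s_central)
  then show ?case using pCons by (simp add: peval_pCons s_mult distrib_left)
qed (simp add: peval_0)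

lemma peval_mult: "peval s a (p * q) = peval s a p * peval s a q"
  by (induct p) (simp_all add: peval_0 peval_pCons peval_add peval_smult s_zero algebra_simps)

lemma peval_const: "peval s a [:c:] = s c"
  by (simp add: peval_pCons peval_0)

lemma peval_1: "peval s a 1 = 1"
  by (simp add: one_pCons peval_const s_one)

fun alt_prod :: "'r \<Rightarrow> 'r \<Rightarrow> complex poly list \<Rightarrow> 'r" where
  "alt_prod a b [] = 1"
| "alt_prod a b [p] = peval s a p"
| "alt_prod a b (p # q # ps) = peval s a p * (b * alt_prod a b (q # ps))"

lemma alt_prod_in: "a \<in> C \<Longrightarrow> b \<in> C \<Longrightarrow> alt_prod a b ps \<in> C"
  by (induct ps rule: induct_list012) (auto intro: one_in mult_in peval_in)

lemma alt_prod_Cons: "ps \<noteq> [] \<Longrightarrow> alt_prod a b (p # ps) = peval s a p * (b * alt_prod a b ps)"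
  by (cases ps) auto

lemma alt_prod_append_add:
  "alt_prod a b (xs @ (p + q) # ys) = alt_prod a b (xs @ p # ys) + alt_prod a b (xs @ q # ys)"
proof (induct xs)
  case Nil
  show ?case by (cases ys) (simp_all add: peval_add algebra_simps)
next
  case (Cons x xs)
  then show ?case by (simp add: alt_prod_Cons distrib_left)
qed

lemma alt_prod_append_const:
  assumes "b * b = s c"
  shows "alt_prod a b (xs @ p # [:d:] # q # ys) = s (c * d) * alt_prod a b (xs @ (p * q) # ys)"
proof (induct xs)
  case Nil
  have "peval s a p * (b * (s d * (b * z))) = s (c * d) * (peval s a p * z)" for z
  proof -
    have "peval s a p * (b * (s d * (b * z))) = peval s a p * ((b * b) * s d * z)"
      by (simp only: mult.assoc s_central[of d])
    also have "\<dots> = peval s a p * s (c * d) * z"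
      by (simp add: assms s_mult mult.assoc)
    finally show ?thesis by (simp only: s_central[of "c * d" "peval s a p", symmetric] mult.assoc)
  qed
  then show ?case by (cases ys) (simp_all add: peval_const peval_mult mult.assoc)
next
  case (Cons x xs)
  have "u * (b * (s (c * d) * v)) = s (c * d) * (u * (b * v))" for u v
    by (metis mult.assoc s_central)
  with Cons show ?case by (simp add: alt_prod_Cons)
qed

lemma psi_centre: "a \<in> C \<Longrightarrow> \<psi> (peval s a (p - [:\<psi> (peval s a p):])) = 0"
  using peval_add[of a "p - [:\<psi> (peval s a p):]" "[:\<psi> (peval s a p):]"]
    psi_add[of "peval s a (p - [:\<psi> (peval s a p):])" "s (\<psi> (peval s a p))"]
    psi_scale[OF one_in, of "\<psi> (peval s a p)"]
  by (simp add: peval_const peval_in s_in psi_one)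

end

fun expansion :: "nat \<Rightarrow> complex poly list list" where
  "expansion 0 = [[1]]"
| "expansion (Suc n) = map (\<lambda>ps. pCons 0 (hd ps) # tl ps) (expansion n) @ map ((#) 1) (expansion n)"

lemma expansion_nonempty: "ps \<in> set (expansion n) \<Longrightarrow> ps \<noteq> []"
  by (induct n) auto

context functional begin

lemma power_expansion: "(a + b) ^ n = (\<Sum>ps\<leftarrow>expansion n. alt_prod a b ps)"
proof (induct n)
  case (Suc n)
  have 1: "alt_prod a b (pCons 0 (hd ps) # tl ps) = a * alt_prod a b ps"
    and 2: "alt_prod a b (1 # ps) = b * alt_prod a b ps" if "ps \<in> set (expansion n)" for ps
  proof -
    obtain p qs where ps: "ps = p # qs"
      using expansion_nonempty \<open>ps \<in> set (expansion n)\<close> by (cases ps) auto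
    show "alt_prod a b (pCons 0 (hd ps) # tl ps) = a * alt_prod a b ps"
      unfolding ps by (cases qs) (simp_all add: peval_pCons s_zero mult.assoc)
    show "alt_prod a b (1 # ps) = b * alt_prod a b ps"
      by (simp add: ps peval_1)
  qed
  have "(\<Sum>ps\<leftarrow>expansion (Suc n). alt_prod a b ps)
    = (\<Sum>ps\<leftarrow>expansion n. a * alt_prod a b ps) + (\<Sum>ps\<leftarrow>expansion n. b * alt_prod a b ps)"
    using 1 2 by (simp add: o_def cong: map_cong)
  then show ?case
    by (simp add: Suc sum_list_const_mult distrib_right)
qed (simp add: peval_1)

lemma psi_sum_list: "(\<And>x. x \<in> set xs \<Longrightarrow> f x \<in> C) \<Longrightarrow>
    \<psi> (\<Sum>x\<leftarrow>xs. f x) = (\<Sum>x\<leftarrow>xs. \<psi> (f x))"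
proof (induct xs)
  case (Cons x xs)
  have "(\<Sum>x\<leftarrow>xs. f x) \<in> C" using Cons.prems
    by (induct xs) (auto intro: zero_in add_in)
  then show ?case using Cons by (simp add: psi_add)
qed (simp add: psi_zero)

lemma psi_power_expansion:
  assumes "a \<in> C" "b \<in> C"
  shows "\<psi> ((a + b) ^ n) = (\<Sum>ps\<leftarrow>expansion n. \<psi> (alt_prod a b ps))"
  unfolding power_expansion by (rule psi_sum_list) (rule alt_prod_in[OF assms])

end

text \<open>The outer factors \<open>p\<close> and \<open>q\<close> need not be centred, because dropping them still leaves the
  adjacent \<open>b\<close>.\<close>

locale free_pair = functional C s \<psi> for C :: "'r::ring_1 set" and s \<psi> +
  fixes a b :: 'r and c :: complex
  assumes a_in: "a \<in> C" and b_in: "b \<in> C" and b_square: "b * b = s c"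
    and centred: "\<And>p q ps. \<forall>x\<in>set ps. \<psi> (peval s a x) = 0 \<Longrightarrow> \<psi> (alt_prod a b (p # ps @ [q])) = 0"
begin

lemma psi_split:
  assumes "m = \<psi> (peval s a d)"
  shows "\<psi> (alt_prod a b (p # cs @ d # e # ds)) =
    \<psi> (alt_prod a b (p # cs @ (d - [:m:]) # e # ds)) +
    c * m * \<psi> (alt_prod a b (butlast (p # cs) @ (last (p # cs) * e) # ds))"
proof -
  have "alt_prod a b (p # cs @ d # e # ds) = alt_prod a b ((p # cs) @ (d - [:m:] + [:m:]) # e # ds)"
    by simp
  also have "\<dots> = alt_prod a b (p # cs @ (d - [:m:]) # e # ds) + alt_prod a b ((p # cs) @ [:m:] # e # ds)"
    unfolding alt_prod_append_add by simp
  also have "(p # cs) @ [:m:] # e # ds = butlast (p # cs) @ last (p # cs) # [:m:] # e # ds"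
    by (metis append.assoc append_Cons append_Nil append_butlast_last_id list.distinct(1))
  also have "alt_prod a b \<dots> = s (c * m) * alt_prod a b (butlast (p # cs) @ (last (p # cs) * e) # ds)"
    by (rule alt_prod_append_const[OF b_square])
  finally show ?thesis
    by (simp only: psi_add psi_scale alt_prod_in a_in b_in mult_in s_in)
qed

end

lemma free_pair_alt_prod_unique:
  fixes s :: "complex \<Rightarrow> 'r::ring_1" and s' :: "complex \<Rightarrow> 'q::ring_1"
  assumes "free_pair C s \<psi> a b c" "free_pair C' s' \<psi>' a' b' c"
    and moments: "\<And>p. \<psi> (peval s a p) = \<psi>' (peval s' a' p)"
  shows "ps \<noteq> [] \<Longrightarrow> \<psi> (functional.alt_prod s a b ps) = \<psi>' (functional.alt_prod s' a' b' ps)"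
proof (induct "length ps" arbitrary: ps rule: less_induct)
  case less
  interpret F: free_pair C s \<psi> a b c by fact
  interpret G: free_pair C' s' \<psi>' a' b' c by fact
  have *: "\<psi> (F.alt_prod a b (p # cs @ ds @ [q])) = \<psi>' (G.alt_prod a' b' (p # cs @ ds @ [q]))"
    if "\<forall>x\<in>set cs. \<psi> (peval s a x) = 0" "length (p # cs @ ds @ [q]) = length ps" for p cs ds q
    using that
  proof (induct ds arbitrary: cs)
    case Nil
    then show ?case using F.centred[of cs p q] G.centred[of cs p q] by (simp add: moments)
  next
    case (Cons d ds)
    obtain e es where e: "ds @ [q] = e # es" by (cases "ds @ [q]") auto
    define m where "m = \<psi> (peval s a d)"
    have "\<psi> (peval s a (d - [:m:])) = 0"
      unfolding m_def by (rule F.psi_centre[OF F.a_in])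
    then have IH: "\<psi> (F.alt_prod a b (p # (cs @ [d - [:m:]]) @ ds @ [q]))
        = \<psi>' (G.alt_prod a' b' (p # (cs @ [d - [:m:]]) @ ds @ [q]))"
      using Cons.prems by (intro Cons.hyps) auto
    have shorter: "\<psi> (F.alt_prod a b (butlast (p # cs) @ (last (p # cs) * e) # es))
        = \<psi>' (G.alt_prod a' b' (butlast (p # cs) @ (last (p # cs) * e) # es))"
    proof (rule less.hyps)
      have "length (ds @ [q]) = length (e # es)" by (simp only: e)
      then show "length (butlast (p # cs) @ (last (p # cs) * e) # es) < length ps"
        using Cons.prems(2) by simp
    qed simp
    have "\<psi> (F.alt_prod a b (p # cs @ d # e # es)) = \<psi>' (G.alt_prod a' b' (p # cs @ d # e # es))"
      unfolding F.psi_split[OF m_def] G.psi_split[OF m_def[unfolded moments]]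
      using IH shorter by (simp add: e)
    then show ?case by (simp add: e)
  qed
  show ?case
  proof (cases "length ps = 1")
    case True
    then obtain p where "ps = [p]" by (auto simp: length_Suc_conv)
    then show ?thesis by (simp add: moments)
  next
    case False
    with less.prems obtain p qs where ps: "ps = p # qs" "qs \<noteq> []" by (cases ps) auto
    then have "ps = p # [] @ butlast qs @ [last qs]" by simp
    then show ?thesis using *[of "[]" p "butlast qs" "last qs"] by simp
  qed
qed

lemma functional_peval_eqI:
  assumes "functional C s \<psi>" "functional C' s' \<psi>'" "a \<in> C" "a' \<in> C'"
    and moments: "\<And>n. \<psi> (a ^ n) = \<psi>' (a' ^ n)"
  shows "\<psi> (peval s a p) = \<psi>' (peval s' a' p)"
proof -
  interpret F: functional C s \<psi> by fact
  interpret G: functional C' s' \<psi>' by fact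
  have "\<psi> (a ^ n * peval s a p) = \<psi>' (a' ^ n * peval s' a' p)" for n
  proof (induct p arbitrary: n)
    case 0
    then show ?case by (simp add: F.peval_0 G.peval_0 F.psi_zero G.psi_zero)
  next
    case (pCons d p)
    have "a ^ n * peval s a (pCons d p) = s d * a ^ n + a ^ Suc n * peval s a p"
      by (simp only: F.peval_pCons distrib_left F.s_central power_Suc2 mult.assoc)
    moreover have "a' ^ n * peval s' a' (pCons d p) = s' d * a' ^ n + a' ^ Suc n * peval s' a' p"
      by (simp only: G.peval_pCons distrib_left G.s_central power_Suc2 mult.assoc)
    ultimately show ?case
      using pCons(2)[of "Suc n"] assms(3,4)
      by (simp add: F.psi_add F.psi_scale F.power_in F.mult_in F.peval_in F.s_in
          G.psi_add G.psi_scale G.power_in G.mult_in G.peval_in G.s_in moments del: power_Suc)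
  qed
  from this[of 0] show ?thesis by simp
qed

lemma free_pair_power_sum_unique:
  assumes F: "free_pair C s \<psi> a b c" and G: "free_pair C' s' \<psi>' a' b' c"
    and moments: "\<And>n. \<psi> (a ^ n) = \<psi>' (a' ^ n)"
  shows "\<psi> ((a + b) ^ n) = \<psi>' ((a' + b') ^ n)"
proof -
  interpret F: free_pair C s \<psi> a b c by fact
  interpret G: free_pair C' s' \<psi>' a' b' c by fact
  have pm: "\<psi> (peval s a p) = \<psi>' (peval s' a' p)" for p
    by (rule functional_peval_eqI)
      (rule F.functional_axioms G.functional_axioms F.a_in G.a_in moments)+
  have "\<psi> (F.alt_prod a b ps) = \<psi>' (G.alt_prod a' b' ps)" if "ps \<in> set (expansion n)" for ps
    by (rule free_pair_alt_prod_unique[OF F G]) (rule pm expansion_nonempty[OF that])+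
  then show ?thesis
    unfolding F.psi_power_expansion[OF F.a_in F.b_in] G.psi_power_expansion[OF G.a_in G.b_in]
    by (simp cong: map_cong)
qed

section \<open>The hermitization of an R-diagonal operator\<close>

datatype 'r m2 = M2 'r 'r 'r 'r

instantiation m2 :: (ring_1) ring_1
begin

definition "0 = M2 0 0 0 0"
definition "1 = M2 1 0 0 1"
fun plus_m2 where "M2 a b c d + M2 a' b' c' d' = M2 (a + a') (b + b') (c + c') (d + d')"
fun minus_m2 where "M2 a b c d - M2 a' b' c' d' = M2 (a - a') (b - b') (c - c') (d - d')"
fun uminus_m2 where "- M2 a b c d = M2 (- a) (- b) (- c) (- d)"
fun times_m2 where "M2 a b c d * M2 a' b' c' d' =
  M2 (a * a' + b * c') (a * b' + b * d') (c * a' + d * c') (c * b' + d * d')"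

instance
proof
  fix x y z :: "'a m2"
  show "x + y + z = x + (y + z)" "x + y = y + x" "x * y * z = x * (y * z)"
    "(x + y) * z = x * z + y * z" "x * (y + z) = x * y + x * z" "x - y = x + - y"
    by (cases x; cases y; cases z; simp add: algebra_simps)+
  show "0 + x = x" "1 * x = x" "x * 1 = x" "- x + x = 0"
    by (cases x; simp add: zero_m2_def one_m2_def)+
  show "(0::'a m2) \<noteq> 1" by (simp add: zero_m2_def one_m2_def)
qed

end

lemma m2_antidiag_power:
  fixes x y :: "'r::ring_1"
  shows "M2 0 x y 0 ^ n = (if even n then M2 ((x * y) ^ (n div 2)) 0 0 ((y * x) ^ (n div 2))
    else M2 0 ((x * y) ^ (n div 2) * x) ((y * x) ^ (n div 2) * y) 0)"
proof -
  have "u * (v * u) ^ k = (u * v) ^ k * u" for u v :: 'r and k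
    by (induct k) (simp_all add: mult.assoc)
  moreover have "(u * v) ^ k * u * v = u * v * (u * v) ^ k" for u v :: 'r and k
    by (metis mult.assoc power_commutes)
  ultimately show ?thesis
    by (induct n) (auto simp: one_m2_def mult.assoc[symmetric])
qed

definition m2_scalar :: "complex \<Rightarrow> ('h::chilbert_space) bop m2" where
  "m2_scalar c = M2 (scalar c) 0 0 (scalar c)"

fun m2_trace :: "('r \<Rightarrow> complex) \<Rightarrow> 'r m2 \<Rightarrow> complex" where
  "m2_trace \<phi> (M2 a b c d) = (\<phi> a + \<phi> d) / 2"

definition m2_carrier :: "'r set \<Rightarrow> 'r m2 set" where
  "m2_carrier N = {M2 a b c d | a b c d. a \<in> N \<and> b \<in> N \<and> c \<in> N \<and> d \<in> N}"

lemma M2_in_carrier [simp]: "M2 a b c d \<in> m2_carrier N \<longleftrightarrow> a \<in> N \<and> b \<in> N \<and> c \<in> N \<and> d \<in> N"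
  by (auto simp: m2_carrier_def)

context tracial_algebra begin

lemma zero_in: "0 \<in> M"
  using scalar_in[of 0] by (simp add: scalar_0)

lemma state_zero: "\<tau> 0 = 0"
  using state_scalar[of 0] by (simp add: scalar_0)

lemma functional_state: "functional M scalar \<tau>"
  by unfold_locales (auto simp: scalar_add scalar_mult scalar_1 state_one state_add state_scalar_mult
      intro: scalar_central scalar_in add_in mult_in)

lemma functional_m2: "functional (m2_carrier M) m2_scalar (m2_trace \<tau>)"
proof
  fix c d :: complex and x y :: "'h bop m2"
  show "m2_scalar (c + d) = (m2_scalar c + m2_scalar d :: 'h bop m2)"
    "m2_scalar (c * d) = (m2_scalar c * m2_scalar d :: 'h bop m2)"
    by (simp_all add: m2_scalar_def scalar_add scalar_mult)
  show "m2_scalar 1 = (1 :: 'h bop m2)"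
    by (simp add: m2_scalar_def scalar_1 one_m2_def)
  show "m2_scalar c * x = x * m2_scalar c"
    by (cases x) (simp add: m2_scalar_def scalar_central)
  show "m2_scalar c \<in> m2_carrier M"
    by (simp add: m2_scalar_def scalar_in zero_in)
  show "m2_trace \<tau> 1 = 1"
    by (simp add: one_m2_def state_one)
  assume x: "x \<in> m2_carrier M"
  show "m2_trace \<tau> (m2_scalar c * x) = c * m2_trace \<tau> x"
    using x by (cases x) (simp add: m2_scalar_def state_scalar_mult algebra_simps)
  assume y: "y \<in> m2_carrier M"
  show "x + y \<in> m2_carrier M" "x * y \<in> m2_carrier M"
    using x y by (cases x; cases y; simp add: add_in mult_in)+
  show "m2_trace \<tau> (x + y) = m2_trace \<tau> x + m2_trace \<tau> y"
    using x y by (cases x; cases y) (simp add: state_add field_simps)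
qed

end

lemma star_algebra_1: "1 \<in> star_algebra S"
  using star_algebra.scal[of 1] by (simp add: scalar_1)

lemma star_algebra_power: "x \<in> star_algebra S \<Longrightarrow> x ^ n \<in> star_algebra S"
  by (induct n) (auto intro: star_algebra.intros star_algebra_1)

lemma star_algebra_diff_scalar: "x \<in> star_algebra S \<Longrightarrow> x - scalar c \<in> star_algebra S"
  using star_algebra.add[OF _ star_algebra.scal, of x S "- c"] by (simp add: scalar_minus)

text \<open>The index \<open>j\<close> names the algebra from which the next factor may be taken.\<close>

inductive alternating :: "(('h::chilbert_space) bop \<Rightarrow> complex) \<Rightarrow> 'h bop \<Rightarrow> 'h bop \<Rightarrow> bool \<Rightarrow> 'h bop \<Rightarrow> bool"
  for \<tau> x y where
  one: "alternating \<tau> x y j 1"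
| step: "alternating \<tau> x y j q \<Longrightarrow> z \<in> star_algebra {if j then x else y} \<Longrightarrow> \<tau> z = 0 \<Longrightarrow>
    alternating \<tau> x y (\<not> j) (q * z)"

lemma alternating_list:
  "alternating \<tau> x y j q \<Longrightarrow> \<exists>js as. length as = length js \<and> distinct_adj js \<and>
    (\<forall>k<length js. as ! k \<in> star_algebra {if js ! k then x else y} \<and> \<tau> (as ! k) = 0) \<and>
    prod_list as = q \<and> (js = [] \<or> last js \<noteq> j)"
proof (induct rule: alternating.induct)
  case (one j)
  show ?case by (rule exI[of _ "[]"], rule exI[of _ "[]"]) simp
next
  case (step j q z)
  then obtain js as where *: "length as = length js" "distinct_adj js"
    "\<forall>k<length js. as ! k \<in> star_algebra {if js ! k then x else y} \<and> \<tau> (as ! k) = 0"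
    "prod_list as = q" "js = [] \<or> last js \<noteq> j" by blast
  have "\<forall>k<length (js @ [j]). (as @ [z]) ! k \<in> star_algebra {if (js @ [j]) ! k then x else y} \<and>
      \<tau> ((as @ [z]) ! k) = 0"
    using *(1,3) step(3,4) by (auto simp: nth_append less_Suc_eq)
  then show ?case
    using * by (intro exI[of _ "js @ [j]"] exI[of _ "as @ [z]"]) (auto simp: distinct_adj_append_iff)
qed

lemma star_free_alternating:
  assumes "star_free \<tau> x y" "alternating \<tau> x y j q" "z \<in> star_algebra {if j then x else y}" "\<tau> z = 0"
  shows "\<tau> (q * z) = 0"
proof -
  obtain js as where *: "length as = length js" "distinct_adj js"
    "\<forall>k<length js. as ! k \<in> star_algebra {if js ! k then x else y} \<and> \<tau> (as ! k) = 0"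
    "prod_list as = q" "js = [] \<or> last js \<noteq> j" using alternating_list[OF assms(2)] by blast
  have "\<forall>k<length (js @ [j]). (as @ [z]) ! k \<in> star_algebra {if (js @ [j]) ! k then x else y} \<and>
    \<tau> ((as @ [z]) ! k) = 0"
    using *(1,3) assms(3,4) by (auto simp: nth_append less_Suc_eq)
  then show ?thesis
    using * assms(1)[unfolded star_free_def, rule_format, of "js @ [j]" "as @ [z]"]
    by (auto simp: distinct_adj_append_iff)
qed

context tracial_algebra begin

interpretation functional M scalar \<tau> by (rule functional_state)

lemma alternating_in: "x \<in> M \<Longrightarrow> y \<in> M \<Longrightarrow> alternating \<tau> x y j q \<Longrightarrow> q \<in> M"
  by (rotate_tac 2, induct rule: alternating.induct)
    (auto intro: one_in mult_in star_algebra_in split: if_splits)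

lemma state_centred: "x \<in> M \<Longrightarrow> \<tau> (x - scalar (\<tau> x)) = 0"
  by (simp add: state_diff scalar_in state_scalar)

lemma peval_in_star_algebra: "peval scalar a p \<in> star_algebra {a :: 'h bop}"
  by (induct p) (auto simp: peval_0 peval_pCons scalar_0[symmetric] intro: star_algebra.intros)

lemma star_free_free_pair:
  assumes a: "a \<in> M" and b: "b \<in> M" and free: "star_free \<tau> a b"
    and b2: "b * b = scalar c" and b0: "\<tau> b = 0"
  shows "free_pair M scalar \<tau> a b c"
proof
  show "a \<in> M" "b \<in> M" "b * b = scalar c" by fact+
  have b_sa: "b \<in> star_algebra {if False then a else b}" by (simp add: star_algebra.base)
  have sa: "peval scalar a p \<in> star_algebra {if True then a else b}" for p
    by (simp add: peval_in_star_algebra)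
  define m where "m p = \<tau> (peval scalar a p)" for p
  define ctr where "ctr p = peval scalar a p - scalar (m p)" for p
  have ctr: "ctr p \<in> star_algebra {if True then a else b}" "\<tau> (ctr p) = 0" "ctr p \<in> M"
    "peval scalar a p = ctr p + scalar (m p)" for p
    unfolding ctr_def m_def using sa[of p]
    by (simp_all add: star_algebra_diff_scalar state_centred peval_in a diff_in scalar_in)
  have tail: "\<tau> (Q * b * alt_prod a b (ps @ [q])) = 0"
    if "alternating \<tau> a b False Q" "\<forall>x\<in>set ps. \<tau> (peval scalar a x) = 0" for Q ps q
    using that
  proof (induct ps arbitrary: Q)
    case Nil
    have Q: "Q \<in> M" using alternating_in[OF a b Nil(1)] .
    have "alternating \<tau> a b True (Q * b)"
      using alternating.step[OF Nil(1) b_sa b0] by simp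
    then have "\<tau> (Q * b * ctr q) = 0"
      using star_free_alternating[OF free] ctr by blast
    moreover have "\<tau> (Q * b) = 0"
      using star_free_alternating[OF free Nil(1) b_sa b0] .
    ultimately show ?case
      using Q b ctr(3)[of q] scalar_in
      by (simp add: ctr(4)[of q] distrib_left state_add mult_in
          scalar_central[of _ "Q * b", symmetric] state_scalar_mult)
  next
    case (Cons x ps)
    have "alternating \<tau> a b True (Q * b)"
      using alternating.step[OF Cons(2) b_sa b0] by simp
    then have "alternating \<tau> a b False (Q * b * peval scalar a x)"
      using alternating.step[OF _ sa] Cons(3) by fastforce
    then have "\<tau> (Q * b * peval scalar a x * b * alt_prod a b (ps @ [q])) = 0"
      using Cons by simp
    then show ?case by (simp add: alt_prod_Cons mult.assoc)
  qed
  fix p q ps assume ps: "\<forall>x\<in>set ps. \<tau> (peval scalar a x) = 0"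
  have "alternating \<tau> a b False (1 * ctr p)"
    using alternating.step[where j = True and x = a and y = b and \<tau> = \<tau>, OF alternating.one ctr(1,2)]
    by simp
  then have "\<tau> (ctr p * b * alt_prod a b (ps @ [q])) = 0"
    using tail ps by fastforce
  moreover have "\<tau> (1 * b * alt_prod a b (ps @ [q])) = 0"
    using tail[OF alternating.one ps] .
  ultimately show "\<tau> (alt_prod a b (p # ps @ [q])) = 0"
    using a b ctr(3)[of p] scalar_in
    by (simp add: alt_prod_Cons ctr(4)[of p] distrib_right state_add mult_in alt_prod_in
        state_scalar_mult mult.assoc)
qed

end

locale haar_pair = tracial_algebra N \<phi> for N :: "('h::chilbert_space) bop set" and \<phi> +
  fixes U H :: "'h bop"
  assumes U_in: "U \<in> N" and H_in: "H \<in> N" and haar: "haar_unitary \<phi> U" and free: "star_free \<phi> U H"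
begin

interpretation m2: functional "m2_carrier N" m2_scalar "m2_trace \<phi>" by (rule functional_m2)

text \<open>All powers of \<open>V\<close> are needed: splitting off the mean of a factor that stands between two equal
  letters \<open>V\<close> merges these letters.\<close>

definition kills :: "'h bop \<Rightarrow> 'h bop \<Rightarrow> bool" where
  "kills V x \<longleftrightarrow> x \<in> N \<and> (\<forall>Q k. alternating \<phi> U H True Q \<longrightarrow> 0 < k \<longrightarrow> \<phi> (Q * V ^ k * x) = 0)"

lemma kills_D: "kills V x \<Longrightarrow> alternating \<phi> U H True Q \<Longrightarrow> 0 < k \<Longrightarrow> \<phi> (Q * V ^ k * x) = 0"
  by (simp add: kills_def)

lemma V_in: "V \<in> {U, adj U} \<Longrightarrow> V \<in> N"
  using U_in adj_in by auto

lemma V_power: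
  assumes "V \<in> {U, adj U}"
  shows "V ^ k \<in> star_algebra {if True then U else H}" "0 < k \<Longrightarrow> \<phi> (V ^ k) = 0"
proof -
  have "V \<in> star_algebra {U}" using assms by (auto intro: star_algebra.intros)
  then show "V ^ k \<in> star_algebra {if True then U else H}" by (simp add: star_algebra_power)
  show "0 < k \<Longrightarrow> \<phi> (V ^ k) = 0" using assms haar by (auto simp: haar_unitary_def)
qed

lemma alternating_in_N: "alternating \<phi> U H j Q \<Longrightarrow> Q \<in> N"
  by (rule alternating_in[OF U_in H_in])

lemma H_algebra_in: "f \<in> star_algebra {H} \<Longrightarrow> f \<in> N"
  by (rule star_algebra_in[OF H_in])

lemma alternating_extend:
  assumes "alternating \<phi> U H True Q" "0 < k" "V \<in> {U, adj U}" "f \<in> star_algebra {H}" "\<phi> f = 0"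
  shows "alternating \<phi> U H True (Q * V ^ k * f)"
  using alternating.step[OF alternating.step[OF assms(1) V_power(1,2)[OF assms(3)]], of k f] assms
  by simp

lemma kills_add: "kills V x \<Longrightarrow> kills V y \<Longrightarrow> V \<in> {U, adj U} \<Longrightarrow> kills V (x + y)"
  unfolding kills_def by (auto simp: distrib_left state_add alternating_in_N power_in mult_in add_in V_in)

lemma kills_scale: "kills V x \<Longrightarrow> V \<in> {U, adj U} \<Longrightarrow> kills V (scalar c * x)"
proof -
  assume *: "kills V x" "V \<in> {U, adj U}"
  have "\<phi> (Q * V ^ k * (scalar c * x)) = c * \<phi> (Q * V ^ k * x)" if "alternating \<phi> U H True Q" for Q k
  proof -
    have "Q * V ^ k * (scalar c * x) = scalar c * (Q * V ^ k * x)"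
      by (metis mult.assoc scalar_central)
    then show ?thesis
      using * that by (simp add: state_scalar_mult kills_def alternating_in_N power_in mult_in V_in)
  qed
  with * show ?thesis by (simp add: kills_def mult_in scalar_in)
qed

lemma kills_centred:
  assumes "kills W x" "V \<in> {U, adj U}" "W \<in> {U, adj U}" "f \<in> star_algebra {H}" "\<phi> f = 0"
  shows "kills V (f * (W * x))"
proof -
  have "\<phi> (Q * V ^ k * (f * (W * x))) = 0" if "alternating \<phi> U H True Q" "0 < k" for Q k
  proof -
    have "alternating \<phi> U H True (Q * V ^ k * f)"
      using that assms(2,4,5) by (rule alternating_extend)
    then have "\<phi> (Q * V ^ k * f * W ^ 1 * x) = 0"
      by (rule kills_D[OF assms(1)]) simp
    then show ?thesis by (simp add: mult.assoc)
  qed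
  then show ?thesis
    using assms by (simp add: kills_def mult_in V_in H_algebra_in)
qed

lemma kills_same:
  assumes "kills V x" "V \<in> {U, adj U}" "f \<in> star_algebra {H}"
  shows "kills V (f * (V * x))"
proof -
  have "kills V (V * x)"
    unfolding kills_def
  proof (intro conjI allI impI)
    show "V * x \<in> N" using assms by (auto simp: kills_def mult_in V_in)
    fix Q and k :: nat assume "alternating \<phi> U H True Q" "0 < k"
    then have "\<phi> (Q * V ^ Suc k * x) = 0" using kills_D[OF assms(1)] by blast
    then show "\<phi> (Q * V ^ k * (V * x)) = 0" by (simp only: power_Suc2 mult.assoc)
  qed
  then have "kills V (scalar (\<phi> f) * (V * x))" using kills_scale assms(2) by blast
  moreover have "kills V ((f - scalar (\<phi> f)) * (V * x))"
    using assms by (intro kills_centred star_algebra_diff_scalar state_centred H_algebra_in)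
  ultimately have "kills V (scalar (\<phi> f) * (V * x) + (f - scalar (\<phi> f)) * (V * x))"
    using kills_add assms(2) by blast
  then show ?thesis by (simp add: left_diff_distrib)
qed

lemma kills_base:
  assumes "V \<in> {U, adj U}" "f \<in> star_algebra {H}"
  shows "kills V f"
proof -
  have "\<phi> (Q * V ^ k * f) = 0" if Q: "alternating \<phi> U H True Q" "0 < k" for Q k
  proof -
    have V: "alternating \<phi> U H False (Q * V ^ k)"
      using alternating.step[OF Q(1) V_power[OF assms(1)] ] Q(2) by fastforce
    have "\<phi> (Q * V ^ k * (f - scalar (\<phi> f))) = 0"
      by (rule star_free_alternating[OF free V])
        (use assms in \<open>auto intro: star_algebra_diff_scalar state_centred H_algebra_in\<close>)
    moreover have "\<phi> (Q * V ^ k * scalar (\<phi> f)) = 0"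
    proof -
      have "\<phi> (Q * V ^ k) = 0"
        using star_free_alternating[OF free Q(1) V_power[OF assms(1)]] Q(2) by blast
      then show ?thesis
        using alternating_in_N[OF V] by (simp add: scalar_central[symmetric] state_scalar_mult)
    qed
    moreover have "Q * V ^ k * f = Q * V ^ k * (f - scalar (\<phi> f)) + Q * V ^ k * scalar (\<phi> f)"
      by (simp add: right_diff_distrib)
    ultimately show ?thesis
      using alternating_in_N[OF V] assms
      by (simp add: state_add mult_in diff_in scalar_in H_algebra_in del: right_diff_distrib)
  qed
  then show ?thesis using assms by (simp add: kills_def H_algebra_in)
qed

lemma kills_state:
  assumes "kills V x" "V \<in> {U, adj U}" "f \<in> star_algebra {H}"
  shows "\<phi> (f * (V * x)) = 0"
proof -
  let ?g = "f - scalar (\<phi> f)"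
  have g: "?g \<in> star_algebra {H}" "\<phi> ?g = 0"
    using assms by (auto intro: star_algebra_diff_scalar state_centred H_algebra_in)
  have "alternating \<phi> U H True (1 * ?g)"
    using alternating.step[OF alternating.one, where z = ?g and j = False and x = U and y = H and \<tau> = \<phi>] g by simp
  then have "\<phi> (?g * V ^ 1 * x) = 0" and "\<phi> (1 * V ^ 1 * x) = 0"
    using kills_D[OF assms(1), of ?g 1] kills_D[OF assms(1) alternating.one, of 1] by simp_all
  moreover have "f * (V * x) = ?g * V ^ 1 * x + scalar (\<phi> f) * (1 * V ^ 1 * x)"
    by (simp add: left_diff_distrib mult.assoc)
  moreover have "?g * V ^ 1 * x \<in> N" "1 * V ^ 1 * x \<in> N" "scalar (\<phi> f) * (1 * V ^ 1 * x) \<in> N"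
    using assms g by (auto simp: kills_def intro: mult_in H_algebra_in V_in scalar_in)
  ultimately show ?thesis by (simp only: state_add state_scalar_mult) simp
qed

definition "hermitization = M2 0 H H 0"

definition "twisted_shift \<beta> = M2 0 (scalar \<beta> * adj U) (scalar (cnj \<beta>) * U) 0"

lemma peval_hermitization:
  "\<exists>e\<in>star_algebra {H}. \<exists>f\<in>star_algebra {H}. peval m2_scalar hermitization p = M2 e f f e"
proof (induct p)
  case 0
  show ?case using star_algebra.scal[of 0 "{H}"]
    by (auto simp: m2.peval_0 zero_m2_def scalar_0)
next
  case (pCons c p)
  then obtain e f where *: "e \<in> star_algebra {H}" "f \<in> star_algebra {H}"
    "peval m2_scalar hermitization p = M2 e f f e" by blast
  have "peval m2_scalar hermitization (pCons c p) = m2_scalar c + hermitization * M2 e f f e"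
    by (simp add: m2.peval_pCons *)
  also have "\<dots> = M2 (scalar c + H * f) (H * e) (H * e) (scalar c + H * f)"
    by (simp add: m2_scalar_def hermitization_def)
  finally show ?case
    using * by (blast intro: star_algebra.intros)
qed

lemma twisted_shift_mult: "twisted_shift \<beta> * M2 x y z w =
    M2 (scalar \<beta> * (adj U * z)) (scalar \<beta> * (adj U * w)) (scalar (cnj \<beta>) * (U * x)) (scalar (cnj \<beta>) * (U * y))"
  by (simp add: twisted_shift_def mult.assoc)

lemma scalar_left_commute: "f * (scalar c * x) = scalar c * (f * x)"
  by (metis mult.assoc scalar_central)

lemma kills_alt_prod:
  assumes "\<forall>p\<in>set ps. m2_trace \<phi> (peval m2_scalar hermitization p) = 0"
  shows "\<exists>x y z w. m2.alt_prod hermitization (twisted_shift \<beta>) (ps @ [q]) = M2 x y z w \<and>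
    kills U x \<and> kills U y \<and> kills (adj U) z \<and> kills (adj U) w"
  using assms
proof (induct ps)
  case Nil
  then show ?case using peval_hermitization[of q] kills_base by auto
next
  case (Cons p ps)
  then obtain x y z w where X: "m2.alt_prod hermitization (twisted_shift \<beta>) (ps @ [q]) = M2 x y z w"
    and k: "kills U x" "kills U y" "kills (adj U) z" "kills (adj U) w" by auto
  obtain e f where e: "e \<in> star_algebra {H}" "f \<in> star_algebra {H}"
    "peval m2_scalar hermitization p = M2 e f f e" using peval_hermitization by blast
  have e0: "\<phi> e = 0" using Cons.prems e(3) by simp
  have "m2.alt_prod hermitization (twisted_shift \<beta>) ((p # ps) @ [q]) =
    M2 (scalar \<beta> * (e * (adj U * z)) + scalar (cnj \<beta>) * (f * (U * x)))
       (scalar \<beta> * (e * (adj U * w)) + scalar (cnj \<beta>) * (f * (U * y)))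
       (scalar \<beta> * (f * (adj U * z)) + scalar (cnj \<beta>) * (e * (U * x)))
       (scalar \<beta> * (f * (adj U * w)) + scalar (cnj \<beta>) * (e * (U * y)))"
    by (simp add: m2.alt_prod_Cons X e(3) twisted_shift_mult scalar_left_commute)
  then show ?case
    using k e(1,2) e0 by (auto intro!: kills_add kills_scale intro: kills_same kills_centred)
qed

lemma haar_free_pair:
  "free_pair (m2_carrier N) m2_scalar (m2_trace \<phi>) hermitization (twisted_shift \<beta>) (\<beta> * cnj \<beta>)"
proof
  show "hermitization \<in> m2_carrier N" "twisted_shift \<beta> \<in> m2_carrier N"
    by (simp_all add: hermitization_def twisted_shift_def H_in U_in zero_in mult_in scalar_in adj_in)
  show "twisted_shift \<beta> * twisted_shift \<beta> = m2_scalar (\<beta> * cnj \<beta>)"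
  proof -
    have "scalar c * x * (scalar d * y) = scalar (c * d) * (x * y)" for c d and x y :: "'h bop"
      by (metis mult.assoc scalar_central scalar_mult)
    then show ?thesis
      using haar by (simp add: twisted_shift_def m2_scalar_def haar_unitary_def mult.commute[of "cnj \<beta>"])
  qed
  fix p q ps assume "\<forall>x\<in>set ps. m2_trace \<phi> (peval m2_scalar hermitization x) = 0"
  then obtain x y z w where X: "m2.alt_prod hermitization (twisted_shift \<beta>) (ps @ [q]) = M2 x y z w"
    and k: "kills U x" "kills U y" "kills (adj U) z" "kills (adj U) w" using kills_alt_prod by blast
  obtain e f where e: "e \<in> star_algebra {H}" "f \<in> star_algebra {H}"
    "peval m2_scalar hermitization p = M2 e f f e" using peval_hermitization by blast
  have "m2.alt_prod hermitization (twisted_shift \<beta>) (p # ps @ [q]) =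
    M2 (scalar \<beta> * (e * (adj U * z)) + scalar (cnj \<beta>) * (f * (U * x)))
       (scalar \<beta> * (e * (adj U * w)) + scalar (cnj \<beta>) * (f * (U * y)))
       (scalar \<beta> * (f * (adj U * z)) + scalar (cnj \<beta>) * (e * (U * x)))
       (scalar \<beta> * (f * (adj U * w)) + scalar (cnj \<beta>) * (e * (U * y)))"
    by (simp add: m2.alt_prod_Cons X e(3) twisted_shift_mult scalar_left_commute)
  moreover have in_N: "g * (V * v) \<in> N" if "g \<in> star_algebra {H}" "V \<in> {U, adj U}" "kills V v" for g V v
    using that by (auto simp: kills_def intro: mult_in H_algebra_in V_in)
  ultimately show "m2_trace \<phi> (m2.alt_prod hermitization (twisted_shift \<beta>) (p # ps @ [q])) = 0"
    using k e(1,2) by (simp add: state_add state_scalar_mult in_N mult_in scalar_in kills_state)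
qed

lemma m2_trace_hermitization_power:
  "m2_trace \<phi> (hermitization ^ n) = (if even n then \<phi> ((H * H) ^ (n div 2)) else 0)"
  by (simp add: hermitization_def m2_antidiag_power state_zero)

lemma m2_trace_shifted_power:
  "m2_trace \<phi> ((hermitization + twisted_shift \<beta>) ^ n) =
    (if even n then \<phi> (((H + scalar (cnj \<beta>) * U) * (H + scalar \<beta> * adj U)) ^ (n div 2)) else 0)"
proof -
  have "\<phi> (((H + scalar (cnj \<beta>) * U) * (H + scalar \<beta> * adj U)) ^ k) =
      \<phi> (((H + scalar \<beta> * adj U) * (H + scalar (cnj \<beta>) * U)) ^ k)" for k
    by (rule state_power_commute) (intro add_in mult_in scalar_in H_in U_in adj_in)+
  then show ?thesis
    by (simp add: hermitization_def twisted_shift_def m2_antidiag_power state_zero)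
qed

end

inductive word_span :: "('h::chilbert_space) bop \<Rightarrow> ('k::chilbert_space) bop \<Rightarrow> 'h bop \<Rightarrow> 'k bop \<Rightarrow> bool"
  for x y where
  word: "word_span x y (scalar c * star_word x w) (scalar c * star_word y w)"
| add: "word_span x y p q \<Longrightarrow> word_span x y p' q' \<Longrightarrow> word_span x y (p + p') (q + q')"

lemma star_word_append: "star_word x (v @ w) = star_word x v * star_word x w"
  by (simp add: star_word_def)

lemma word_span_mult:
  "word_span x y p q \<Longrightarrow> word_span x y p' q' \<Longrightarrow> word_span x y (p * p') (q * q')"
proof (induct rule: word_span.induct)
  case (word c w)
  have *: "scalar c * u * (scalar d * v) = scalar (c * d) * (u * v)" for c d
    and u v :: "('z::chilbert_space) bop"
    by (metis mult.assoc scalar_central scalar_mult)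
  from word show ?case
  proof (induct rule: word_span.induct)
    case (word d v)
    show ?case unfolding * star_word_append[symmetric] by (rule word_span.word)
  qed (auto simp: distrib_left intro: word_span.add)
qed (auto simp: distrib_right intro: word_span.add)

lemma word_span_power: "word_span x y p q \<Longrightarrow> word_span x y (p ^ n) (q ^ n)"
proof (induct n)
  case 0
  show ?case using word_span.word[of x y 1 "[]"] by (simp add: scalar_1 star_word_def)
qed (auto intro: word_span_mult)

lemma word_span_state:
  assumes "tracial_algebra M \<tau>" "tracial_algebra N \<phi>" "x \<in> M" "y \<in> N" "same_star_distribution \<tau> x \<phi> y"
    and "word_span x y p q"
  shows "\<tau> p = \<phi> q"
proof -
  interpret M: tracial_algebra M \<tau> by fact
  interpret N: tracial_algebra N \<phi> by fact
  have words: "star_word x w \<in> M" "star_word y w \<in> N" for w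
    using assms(3,4) by (induct w) (auto simp: star_word_def M.one_in N.one_in M.adj_in N.adj_in
        intro!: M.mult_in N.mult_in)
  from assms(6) have "p \<in> M \<and> q \<in> N \<and> \<tau> p = \<phi> q"
  proof (induct rule: word_span.induct)
    case (word c w)
    then show ?case using words assms(5)
      by (simp add: same_star_distribution_def M.state_scalar_mult N.state_scalar_mult
          M.mult_in N.mult_in M.scalar_in N.scalar_in)
  next
    case (add p q p' q')
    then show ?case by (simp add: M.state_add N.state_add M.add_in N.add_in)
  qed
  then show ?thesis by blast
qed

lemma (in tracial_algebra) adj_diff_scalar: "x \<in> M \<Longrightarrow> adj (x - scalar c) = adj x - scalar (cnj c)"
  by (intro adj_eqI is_adjoint_diff is_adjoint_scalar is_adjoint_adj)

lemma word_span_shift: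
  fixes x :: "('h::chilbert_space) bop" and y :: "('k::chilbert_space) bop"
  assumes "tracial_algebra M \<tau>" "tracial_algebra N \<phi>" "x \<in> M" "y \<in> N"
  shows "word_span x y (adj (x - scalar c) * (x - scalar c)) (adj (y - scalar c) * (y - scalar c))"
proof -
  have g: "word_span x y x y" "word_span x y (adj x) (adj y)"
    "word_span x y (scalar d) (scalar d)" for d
    using word_span.word[of x y 1 "[False]"] word_span.word[of x y 1 "[True]"]
      word_span.word[of x y d "[]"] by (simp_all add: star_word_def scalar_1)
  have "word_span x y (x + scalar (- c)) (y + scalar (- c))"
    "word_span x y (adj x + scalar (- cnj c)) (adj y + scalar (- cnj c))"
    using g word_span.add by blast+
  then show ?thesis
    using assms by (intro word_span_mult)
      (simp_all add: tracial_algebra.adj_diff_scalar scalar_minus)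
qed

lemma free_shift_moments:
  fixes M :: "('h::chilbert_space) bop set" and N :: "('l::chilbert_space) bop set"
  assumes M: "tracial_algebra M \<tau>" and T: "T \<in> M" and R: "R_diagonal TYPE('k::chilbert_space) \<tau> T"
    and N: "tracial_algebra N \<phi>" and a: "a \<in> N" and b: "b \<in> N" and free: "star_free \<phi> a b"
    and b2: "b * b = scalar (complex_of_real ((cmod lam)\<^sup>2))" and b0: "\<phi> b = 0"
    and moments: "\<And>n. \<phi> (a ^ n) = (if even n then \<tau> ((adj T * T) ^ (n div 2)) else 0)"
  shows "\<phi> ((a + b) ^ n) =
    (if even n then \<tau> ((adj (T - scalar lam) * (T - scalar lam)) ^ (n div 2)) else 0)"
proof -
  obtain K :: "'k bop set" and \<kappa> U H where K: "tracial_vn_algebra K \<kappa>" "U \<in> K" "H \<in> K"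
    "haar_unitary \<kappa> U" "positive_op H" "star_free \<kappa> U H" "same_star_distribution \<tau> T \<kappa> (U * H)"
    using R unfolding R_diagonal_def by blast
  interpret M: tracial_algebra M \<tau> by fact
  interpret N: tracial_algebra N \<phi> by fact
  interpret K: haar_pair K \<kappa> U H using K by unfold_locales auto
  have UH: "U * H \<in> K" using K by (simp add: K.mult_in)
  have UU: "adj U * U = 1" "U * adj U = 1" using K(4) by (auto simp: haar_unitary_def)
  have adjH: "adj H = H"
    using positive_op_self_adjoint[OF K(5) K.is_adjoint_adj[OF K(3)]] by (rule adj_eqI)
  have adjUH: "adj (U * H) = H * adj U"
    using K by (simp add: K.adj_mult adjH)
  have transfer: "\<tau> ((adj (T - scalar c) * (T - scalar c)) ^ k)
      = \<kappa> ((adj (U * H - scalar c) * (U * H - scalar c)) ^ k)" for c k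
    by (rule word_span_state[OF M K.tracial_algebra_axioms T UH K(7)])
      (rule word_span_power[OF word_span_shift[OF M K.tracial_algebra_axioms T UH]])
  have "H * adj U * (U * H) = H * H"
    by (metis UU(1) mult.assoc mult_1)
  then have 1: "\<tau> ((adj T * T) ^ k) = \<kappa> ((H * H) ^ k)" for k
    using transfer[of 0 k] by (simp add: scalar_0 adjUH)
  have "adj (U * H - scalar lam) * (U * H - scalar lam)
      = (H * adj U - scalar (cnj lam)) * (U * H - scalar lam)"
    using UH by (simp add: K.adj_diff_scalar adjUH)
  also have "\<dots> = H * (adj U * U) * H - scalar lam * H * adj U - scalar (cnj lam) * U * H
      + scalar (cnj lam) * scalar lam"
    by (simp add: algebra_simps scalar_central[of lam])
  also have "\<dots> = (H + scalar (cnj (- lam)) * U) * (H + scalar (- lam) * adj U)"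
  proof -
    have "scalar (cnj lam) * U * (scalar lam * adj U) = scalar (cnj lam) * scalar lam"
      using UU(2) by (metis mult.assoc mult.right_neutral scalar_central)
    moreover have "H * (scalar lam * adj U) = scalar lam * H * adj U"
      by (metis mult.assoc scalar_central)
    ultimately show ?thesis by (simp add: UU scalar_minus algebra_simps)
  qed
  finally have 2: "\<tau> ((adj (T - scalar lam) * (T - scalar lam)) ^ k)
      = \<kappa> (((H + scalar (cnj (- lam)) * U) * (H + scalar (- lam) * adj U)) ^ k)" for k
    by (simp only: transfer)
  have c: "- lam * cnj (- lam) = complex_of_real ((cmod lam)\<^sup>2)"
    by (simp only: complex_norm_square) simp
  have "\<phi> ((a + b) ^ n) = m2_trace \<kappa> ((K.hermitization + K.twisted_shift (- lam)) ^ n)"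
    by (rule free_pair_power_sum_unique[OF N.star_free_free_pair[OF a b free b2 b0]
          K.haar_free_pair[of "- lam", unfolded c]])
      (simp add: moments 1 K.m2_trace_hermitization_power)
  then show ?thesis by (simp only: 2 K.m2_trace_shifted_power)
qed

section \<open>Symmetrizations and Cauchy transforms\<close>

lemma
  fixes \<sigma>\<^sub>1 \<sigma>\<^sub>2 :: "real measure"
  assumes "sets \<sigma>\<^sub>1 = sets borel" "sets \<sigma>\<^sub>2 = sets borel"
  shows sets_half_sum: "sets (half_sum \<sigma>\<^sub>1 \<sigma>\<^sub>2) = sets borel"
    and emeasure_half_sum: "B \<in> sets borel \<Longrightarrow>
      emeasure (half_sum \<sigma>\<^sub>1 \<sigma>\<^sub>2) B = (emeasure \<sigma>\<^sub>1 B + emeasure \<sigma>\<^sub>2 B) / 2"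
proof -
  show sets: "sets (half_sum \<sigma>\<^sub>1 \<sigma>\<^sub>2) = sets borel"
    by (metis half_sum_def sets.sigma_sets_eq sets_measure_of_conv space_borel sets.space_closed)
  assume B: "B \<in> sets borel"
  show "emeasure (half_sum \<sigma>\<^sub>1 \<sigma>\<^sub>2) B = (emeasure \<sigma>\<^sub>1 B + emeasure \<sigma>\<^sub>2 B) / 2"
  proof (rule emeasure_measure_of[OF half_sum_def])
    show "countably_additive (sets (half_sum \<sigma>\<^sub>1 \<sigma>\<^sub>2)) (\<lambda>B. (emeasure \<sigma>\<^sub>1 B + emeasure \<sigma>\<^sub>2 B) / 2)"
      unfolding countably_additive_def
    proof (intro allI impI)
      fix A :: "nat \<Rightarrow> real set"
      assume A: "range A \<subseteq> sets (half_sum \<sigma>\<^sub>1 \<sigma>\<^sub>2)" "disjoint_family A"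
      have "(\<Sum>i. emeasure \<sigma>\<^sub>1 (A i) + emeasure \<sigma>\<^sub>2 (A i)) =
          emeasure \<sigma>\<^sub>1 (\<Union>(range A)) + emeasure \<sigma>\<^sub>2 (\<Union>(range A))"
        using A sets assms by (simp add: suminf_add[symmetric] suminf_emeasure)
      then show "(\<Sum>i. (emeasure \<sigma>\<^sub>1 (A i) + emeasure \<sigma>\<^sub>2 (A i)) / 2) =
          (emeasure \<sigma>\<^sub>1 (\<Union>(range A)) + emeasure \<sigma>\<^sub>2 (\<Union>(range A))) / 2"
        by (simp add: divide_ennreal_def)
    qed
  qed (use B sets in \<open>auto simp: positive_def\<close>)
qed

lemma space_half_sum: "space (half_sum \<sigma>\<^sub>1 \<sigma>\<^sub>2) = UNIV"
  by (simp add: half_sum_def space_measure_of_conv)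

lemma nn_integral_half_sum:
  fixes \<sigma>\<^sub>1 \<sigma>\<^sub>2 :: "real measure"
  assumes sets: "sets \<sigma>\<^sub>1 = sets borel" "sets \<sigma>\<^sub>2 = sets borel" and "f \<in> borel_measurable borel"
  shows "(\<integral>\<^sup>+x. f x \<partial>half_sum \<sigma>\<^sub>1 \<sigma>\<^sub>2) = ((\<integral>\<^sup>+x. f x \<partial>\<sigma>\<^sub>1) + (\<integral>\<^sup>+x. f x \<partial>\<sigma>\<^sub>2)) / 2"
proof -
  have meas: "g \<in> borel_measurable \<sigma>\<^sub>1" "g \<in> borel_measurable \<sigma>\<^sub>2" "g \<in> borel_measurable (half_sum \<sigma>\<^sub>1 \<sigma>\<^sub>2)"
    if "g \<in> borel_measurable borel" for g :: "real \<Rightarrow> ennreal"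
    using that measurable_cong_sets[OF sets(1) refl] measurable_cong_sets[OF sets(2) refl]
      measurable_cong_sets[OF sets_half_sum[OF sets] refl] by blast+
  show ?thesis
    using assms(3)
  proof (induct rule: borel_measurable_induct)
    case (cong f g)
    then show ?case by (metis nn_integral_cong UNIV_I space_borel)
  next
    case (set A)
    then show ?case using sets by (simp add: sets_half_sum emeasure_half_sum)
  next
    case (mult u c)
    then show ?case
      by (simp add: meas nn_integral_cmult divide_ennreal_def algebra_simps)
  next
    case (add u v)
    then show ?case
      by (simp add: meas nn_integral_add divide_ennreal_def algebra_simps)
  next
    case (seq U)
    have "(\<integral>\<^sup>+x. (SUP i. U i x) \<partial>N) = (SUP i. \<integral>\<^sup>+x. U i x \<partial>N)"
      if "\<And>i. U i \<in> borel_measurable N" for N :: "real measure"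
      using seq(4) that by (intro nn_integral_monotone_convergence_SUP) auto
    note mono = this
    have inc: "incseq (\<lambda>i. \<integral>\<^sup>+x. U i x \<partial>N)" for N :: "real measure"
      using seq(4) by (auto simp: incseq_def le_fun_def intro!: nn_integral_mono)
    have "(SUP i. \<integral>\<^sup>+x. U i x \<partial>\<sigma>\<^sub>1) + (SUP i. \<integral>\<^sup>+x. U i x \<partial>\<sigma>\<^sub>2)
        = (SUP i. (\<integral>\<^sup>+x. U i x \<partial>\<sigma>\<^sub>1) + (\<integral>\<^sup>+x. U i x \<partial>\<sigma>\<^sub>2))"
      by (rule ennreal_SUP_add[symmetric]) (rule inc)+
    then show ?case
      using seq by (simp add: image_comp mono meas SUP_apply SUP_divide_ennreal)
  qed
qed

lemma
  fixes f :: "real \<Rightarrow> complex"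
  assumes sets: "sets \<sigma>\<^sub>1 = sets borel" "sets \<sigma>\<^sub>2 = sets borel"
    and int: "integrable \<sigma>\<^sub>1 f" "integrable \<sigma>\<^sub>2 f"
  shows integral_half_sum: "(\<integral>x. f x \<partial>half_sum \<sigma>\<^sub>1 \<sigma>\<^sub>2) = ((\<integral>x. f x \<partial>\<sigma>\<^sub>1) + (\<integral>x. f x \<partial>\<sigma>\<^sub>2)) / 2"
proof -
  let ?h = "half_sum \<sigma>\<^sub>1 \<sigma>\<^sub>2"
  have meas: "g \<in> borel_measurable \<sigma>\<^sub>1 \<longleftrightarrow> g \<in> borel_measurable borel"
    "g \<in> borel_measurable ?h \<longleftrightarrow> g \<in> borel_measurable borel"
    for g :: "real \<Rightarrow> 'b::topological_space"
    using measurable_cong_sets[OF sets(1) refl]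
      measurable_cong_sets[OF sets_half_sum[OF sets] refl] by blast+
  have mean: "(x + y) / 2 = ennreal ((enn2real x + enn2real y) / 2)"
    if "x < \<infinity>" "y < \<infinity>" for x y :: ennreal
  proof -
    have "(ennreal (enn2real x) + ennreal (enn2real y)) / ennreal 2 = ennreal ((enn2real x + enn2real y) / 2)"
      by (simp add: divide_ennreal flip: ennreal_plus del: ennreal_numeral)
    then show ?thesis using that by (simp add: ennreal_enn2real)
  qed
  then have fin: "(x + y) / 2 < \<infinity>" if "x < \<infinity>" "y < \<infinity>" for x y :: ennreal
    using that by simp
  have f: "f \<in> borel_measurable borel" using borel_measurable_integrable[OF int(1)] by (simp only: meas(1))
  have real: "integrable ?h g \<and> (\<integral>x. g x \<partial>?h) = ((\<integral>x. g x \<partial>\<sigma>\<^sub>1) + (\<integral>x. g x \<partial>\<sigma>\<^sub>2)) / 2"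
    if g: "integrable \<sigma>\<^sub>1 g" "integrable \<sigma>\<^sub>2 g" for g :: "real \<Rightarrow> real"
  proof
    have gm: "g \<in> borel_measurable borel" using borel_measurable_integrable[OF g(1)] by (simp only: meas(1))
    show ig: "integrable ?h g"
      using g gm fin unfolding integrable_iff_bounded
      by (simp add: nn_integral_half_sum[OF sets] meas)
    have half: "enn2real ((x + y) / 2) = (enn2real x + enn2real y) / 2" if "x < \<infinity>" "y < \<infinity>" for x y
      using mean[OF that] by simp
    have "(\<integral>\<^sup>+x. ennreal (g x) \<partial>N) < \<infinity>" "(\<integral>\<^sup>+x. ennreal (- g x) \<partial>N) < \<infinity>" if "integrable N g" for N :: "real measure"
      using that by (auto simp: real_integrable_def less_top)
    then show "(\<integral>x. g x \<partial>?h) = ((\<integral>x. g x \<partial>\<sigma>\<^sub>1) + (\<integral>x. g x \<partial>\<sigma>\<^sub>2)) / 2"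
      using g gm ig
      by (simp add: real_lebesgue_integral_def nn_integral_half_sum[OF sets] half field_simps)
  qed
  have "integrable ?h f"
    using int f fin unfolding integrable_iff_bounded
    by (simp add: nn_integral_half_sum[OF sets] meas)
  then show ?thesis
    using int real[of "\<lambda>x. Re (f x)"] real[of "\<lambda>x. Im (f x)"]
    by (simp add: complex_eq_iff integral_Re[symmetric] integral_Im[symmetric] integrable_Re integrable_Im del: integral_Re integral_Im)
qed

definition supported :: "real measure \<Rightarrow> real \<Rightarrow> bool" where
  "supported \<sigma> r \<longleftrightarrow> real_distribution \<sigma> \<and> (AE x in \<sigma>. \<bar>x\<bar> \<le> r)"

lemma supportedI:
  assumes "real_distribution \<sigma>" "measure \<sigma> {-r..r} = 1"
  shows "supported \<sigma> r"
proof -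
  interpret real_distribution \<sigma> by fact
  have "AE x in \<sigma>. x \<in> {-r..r}"
    using assms(2) by (intro AE_prob_1) simp
  then have "AE x in \<sigma>. \<bar>x\<bar> \<le> r" by eventually_elim auto
  then show ?thesis using assms by (simp add: supported_def)
qed

lemma supported_mono: "supported \<sigma> r \<Longrightarrow> r \<le> s \<Longrightarrow> supported \<sigma> s"
  unfolding supported_def by (auto elim!: eventually_mono)

lemma supported_integrable:
  fixes f :: "real \<Rightarrow> 'b::{banach, second_countable_topology}"
  assumes "supported \<sigma> r" "continuous_on UNIV f"
  shows "integrable \<sigma> f"
proof -
  interpret real_distribution \<sigma> using assms by (simp add: supported_def)
  have "compact (f ` {-r..r})"
    using assms(2) by (intro compact_continuous_image) (auto intro: continuous_on_subset)
  then obtain B where B: "\<forall>x\<in>{-r..r}. norm (f x) \<le> B"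
    using compact_imp_bounded[of "f ` {-r..r}"] by (auto simp: bounded_iff)
  show ?thesis
  proof (rule integrable_const_bound[of _ B])
    show "AE x in \<sigma>. norm (f x) \<le> B"
      using assms(1) unfolding supported_def by (auto elim!: eventually_mono intro!: B[rule_format])
    show "f \<in> borel_measurable \<sigma>"
      using borel_measurable_continuous_onI[OF assms(2)]
      by (simp cong: measurable_cong_sets)
  qed
qed

lemma supported_integral_bound:
  fixes f :: "real \<Rightarrow> real"
  assumes "supported \<sigma> r" "continuous_on UNIV f" "\<And>x. \<bar>x\<bar> \<le> r \<Longrightarrow> \<bar>f x\<bar> \<le> B"
  shows "\<bar>\<integral>x. f x \<partial>\<sigma>\<bar> \<le> B"
proof -
  interpret real_distribution \<sigma> using assms by (simp add: supported_def)
  have int: "integrable \<sigma> f" by (rule supported_integrable[OF assms(1,2)])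
  have "\<bar>\<integral>x. f x \<partial>\<sigma>\<bar> \<le> (\<integral>x. \<bar>f x\<bar> \<partial>\<sigma>)" by (rule integral_abs_bound)
  also have "\<dots> \<le> (\<integral>x. B \<partial>\<sigma>)"
    using int assms(1,3) unfolding supported_def
    by (intro integral_mono_AE) (auto elim!: eventually_mono)
  finally show ?thesis using prob_space by simp
qed

lemma supported_integral_eqI:
  fixes f :: "real \<Rightarrow> real"
  assumes \<sigma>: "supported \<sigma> r" and \<sigma>': "supported \<sigma>' r"
    and moments: "\<And>n. (\<integral>x. x ^ n \<partial>\<sigma>) = (\<integral>x. x ^ n \<partial>\<sigma>')" and f: "continuous_on UNIV f"
  shows "(\<integral>x. f x \<partial>\<sigma>) = (\<integral>x. f x \<partial>\<sigma>')"
proof -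
  have "\<bar>(\<integral>x. f x \<partial>\<sigma>) - (\<integral>x. f x \<partial>\<sigma>')\<bar> \<le> 0 + e" if "0 < e" for e
  proof -
    obtain g where "real_polynomial_function g" and g: "\<And>x. x \<in> {-r..r} \<Longrightarrow> \<bar>f x - g x\<bar> < e / 2"
      using Stone_Weierstrass_real_polynomial_function[of "{-r..r}" f "e / 2"] f \<open>0 < e\<close>
      by (auto intro: continuous_on_subset)
    then obtain a and n :: nat where ga: "g = (\<lambda>x. \<Sum>i\<le>n. a i * x ^ i)"
      by (auto simp: real_polynomial_function_iff_sum)
    have gc: "continuous_on UNIV g" unfolding ga by (intro continuous_intros)
    have mono: "integrable N (\<lambda>x. x ^ i)" if "supported N r" for N and i
      by (rule supported_integrable[OF that]) (intro continuous_intros)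
    have "(\<integral>x. g x \<partial>N) = (\<Sum>i\<le>n. a i * (\<integral>x. x ^ i \<partial>N))" if "supported N r" for N
      using mono[OF that] by (simp add: ga)
    then have eq: "(\<integral>x. g x \<partial>\<sigma>) = (\<integral>x. g x \<partial>\<sigma>')"
      using \<sigma> \<sigma>' moments by simp
    have close: "\<bar>(\<integral>x. f x \<partial>N) - (\<integral>x. g x \<partial>N)\<bar> \<le> e / 2" if N: "supported N r" for N
    proof -
      have "\<bar>\<integral>x. f x - g x \<partial>N\<bar> \<le> e / 2"
      proof (rule supported_integral_bound[OF N])
        show "\<bar>f x - g x\<bar> \<le> e / 2" if "\<bar>x\<bar> \<le> r" for x
          using g[of x] that by (simp add: abs_le_iff)
      qed (intro continuous_on_diff f gc)
      then show ?thesis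
        using supported_integrable[OF N f] supported_integrable[OF N gc] by simp
    qed
    show ?thesis using close[OF \<sigma>] close[OF \<sigma>'] eq by linarith
  qed
  then show ?thesis using field_le_epsilon[of "\<bar>(\<integral>x. f x \<partial>\<sigma>) - (\<integral>x. f x \<partial>\<sigma>')\<bar>" 0] by simp
qed

lemma resolvent_continuous: "Im z \<noteq> 0 \<Longrightarrow> continuous_on UNIV (\<lambda>x. 1 / (z - complex_of_real x))"
  by (intro continuous_intros) (auto simp: complex_eq_iff)

lemma cauchy_transform_eqI:
  assumes \<sigma>: "supported \<sigma> r" and \<sigma>': "supported \<sigma>' r"
    and moments: "\<And>n. (\<integral>x. x ^ n \<partial>\<sigma>) = (\<integral>x. x ^ n \<partial>\<sigma>')" and z: "Im z \<noteq> 0"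
  shows "cauchy_transform \<sigma> z = cauchy_transform \<sigma>' z"
proof -
  let ?f = "\<lambda>x. 1 / (z - complex_of_real x)"
  have f: "continuous_on UNIV ?f" by (rule resolvent_continuous[OF z])
  have "(\<integral>x. Re (?f x) \<partial>\<sigma>) = (\<integral>x. Re (?f x) \<partial>\<sigma>')" "(\<integral>x. Im (?f x) \<partial>\<sigma>) = (\<integral>x. Im (?f x) \<partial>\<sigma>')"
    by (rule supported_integral_eqI[OF \<sigma> \<sigma>' moments]; intro continuous_intros f)+
  then show ?thesis
    unfolding cauchy_transform_def complex_eq_iff
    using supported_integrable[OF \<sigma> f] supported_integrable[OF \<sigma>' f]
    by (simp add: integral_Re integral_Im)
qed

lemma real_distribution_half_sum:
  assumes "real_distribution \<sigma>\<^sub>1" "real_distribution \<sigma>\<^sub>2"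
  shows "real_distribution (half_sum \<sigma>\<^sub>1 \<sigma>\<^sub>2)"
proof -
  interpret s1: real_distribution \<sigma>\<^sub>1 by fact
  interpret s2: real_distribution \<sigma>\<^sub>2 by fact
  have "emeasure (half_sum \<sigma>\<^sub>1 \<sigma>\<^sub>2) UNIV = 1"
    using s1.emeasure_space_1 s2.emeasure_space_1 by (simp add: emeasure_half_sum)
  then have "prob_space (half_sum \<sigma>\<^sub>1 \<sigma>\<^sub>2)"
    by (intro prob_spaceI) (simp add: space_half_sum)
  then show ?thesis
    by (simp add: real_distribution_def real_distribution_axioms_def sets_half_sum)
qed

lemma supported_symmetrization:
  assumes "supported \<sigma> r"
  shows "supported (symmetrization \<sigma>) r"
proof (rule supportedI)
  interpret real_distribution \<sigma> using assms by (simp add: supported_def)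
  have d: "real_distribution (distr \<sigma> borel uminus)"
    by (rule real_distribution_distr) simp
  then show "real_distribution (symmetrization \<sigma>)"
    unfolding symmetrization_def by (intro real_distribution_half_sum real_distribution_axioms)
  have "AE x in \<sigma>. x \<in> {-r..r}"
    using assms unfolding supported_def by (auto elim!: eventually_mono)
  then have 1: "emeasure \<sigma> {-r..r} = 1"
    by (simp add: emeasure_eq_1_AE)
  have "uminus -` {-r..r} = {-r..r}" by auto
  then have "emeasure (distr \<sigma> borel uminus) {-r..r} = 1"
    using 1 by (simp add: emeasure_distr)
  then have "emeasure (symmetrization \<sigma>) {-r..r} = 1"
    using 1 by (simp add: symmetrization_def emeasure_half_sum)
  then show "measure (symmetrization \<sigma>) {-r..r} = 1"
    by (simp add: measure_def)
qed

lemma integral_symmetrization: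
  fixes f :: "real \<Rightarrow> complex"
  assumes "supported \<sigma> r" "continuous_on UNIV f"
  shows "(\<integral>x. f x \<partial>symmetrization \<sigma>) = ((\<integral>x. f x \<partial>\<sigma>) + (\<integral>x. f (- x) \<partial>\<sigma>)) / 2"
proof -
  interpret real_distribution \<sigma> using assms by (simp add: supported_def)
  have f: "f \<in> borel_measurable borel" using assms(2) by (rule borel_measurable_continuous_onI)
  have c: "continuous_on UNIV (\<lambda>x. f (- x))"
    by (rule continuous_on_compose2[OF assms(2)]) (auto intro: continuous_intros)
  have "integrable (distr \<sigma> borel uminus) f"
    using supported_integrable[OF assms(1) c] f by (subst integrable_distr_eq) auto
  then show ?thesis
    using supported_integrable[OF assms] f unfolding symmetrization_def
    by (subst integral_half_sum) (auto simp: integral_distr)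
qed

lemma symmetrization_moments:
  assumes "supported \<sigma> r"
  shows "(\<integral>x. x ^ n \<partial>symmetrization \<sigma>) = (if even n then \<integral>x. x ^ n \<partial>\<sigma> else 0)"
proof -
  have "complex_of_real (\<integral>x. x ^ n \<partial>symmetrization \<sigma>) = (\<integral>x. complex_of_real (x ^ n) \<partial>symmetrization \<sigma>)"
    by (simp only: integral_complex_of_real)
  also have "\<dots> = ((\<integral>x. complex_of_real (x ^ n) \<partial>\<sigma>) + (\<integral>x. complex_of_real ((- x) ^ n) \<partial>\<sigma>)) / 2"
    by (rule integral_symmetrization[OF assms]) (intro continuous_intros)
  also have "\<dots> = complex_of_real (if even n then \<integral>x. x ^ n \<partial>\<sigma> else 0)"
    by (simp add: power_minus_odd del: of_real_power)
  finally show ?thesis by (simp only: of_real_eq_iff)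
qed

lemma cauchy_transform_symmetrization_imaginary:
  assumes "supported \<sigma> r" "0 < y"
  shows "cauchy_transform (symmetrization \<sigma>) (\<i> * complex_of_real y) =
    - \<i> * complex_of_real (y * (\<integral>x. 1 / (y\<^sup>2 + x\<^sup>2) \<partial>\<sigma>))"
proof -
  let ?f = "\<lambda>x. 1 / (\<i> * complex_of_real y - complex_of_real x)"
  have c: "continuous_on UNIV ?f" using assms(2) by (intro resolvent_continuous) simp
  have c': "continuous_on UNIV (\<lambda>x. ?f (- x))"
    by (rule continuous_on_compose2[OF c]) (auto intro: continuous_intros)
  have "cauchy_transform (symmetrization \<sigma>) (\<i> * complex_of_real y) =
      ((\<integral>x. ?f x \<partial>\<sigma>) + (\<integral>x. ?f (- x) \<partial>\<sigma>)) / 2"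
    unfolding cauchy_transform_def by (rule integral_symmetrization[OF assms(1) c])
  also have "\<dots> = (\<integral>x. (?f x + ?f (- x)) / 2 \<partial>\<sigma>)"
    using supported_integrable[OF assms(1) c] supported_integrable[OF assms(1) c'] by simp
  also have "\<dots> = (\<integral>x. - \<i> * complex_of_real (y * (1 / (y\<^sup>2 + x\<^sup>2))) \<partial>\<sigma>)"
  proof (rule Bochner_Integration.integral_cong[OF refl])
    fix x
    have half: "(2 * a / b) / 2 = a / b" for a b :: complex by simp
    have nz: "\<i> * complex_of_real y - complex_of_real x \<noteq> 0" "\<i> * complex_of_real y + complex_of_real x \<noteq> 0"
      using assms(2) by (auto simp: complex_eq_iff)
    have prod: "(\<i> * complex_of_real y - complex_of_real x) * (\<i> * complex_of_real y + complex_of_real x)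
        = - complex_of_real (y\<^sup>2 + x\<^sup>2)"
      by (simp add: algebra_simps power2_eq_square)
    have "?f x + ?f (- x) = 2 * (\<i> * complex_of_real y) / (- complex_of_real (y\<^sup>2 + x\<^sup>2))"
      unfolding of_real_minus diff_minus_eq_add add_frac_eq[OF nz] prod by simp
    then have "(?f x + ?f (- x)) / 2 = \<i> * complex_of_real y / (- complex_of_real (y\<^sup>2 + x\<^sup>2))"
      by (simp only: half)
    also have "\<dots> = - \<i> * complex_of_real (y * (1 / (y\<^sup>2 + x\<^sup>2)))"
      by (simp only: of_real_mult of_real_divide of_real_1 divide_minus_right times_divide_eq_right
          mult_1_right mult_minus_left minus_divide_left[symmetric])
    finally show "(?f x + ?f (- x)) / 2 = - \<i> * complex_of_real (y * (1 / (y\<^sup>2 + x\<^sup>2)))" .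
  qed
  also have "\<dots> = - \<i> * complex_of_real (y * (\<integral>x. 1 / (y\<^sup>2 + x\<^sup>2) \<partial>\<sigma>))"
    by (simp only: integral_mult_right_zero integral_complex_of_real)
  finally show ?thesis .
qed

lemma integral_two_point:
  fixes f :: "real \<Rightarrow> complex"
  assumes "f \<in> borel_measurable borel"
  shows "(\<integral>x. f x \<partial>two_point r) = (f r + f (- r)) / 2"
proof -
  have "integrable (return borel t) f" for t
    using assms by (simp add: integrable_iff_bounded nn_integral_return)
  then show ?thesis
    unfolding two_point_def using assms by (subst integral_half_sum) (auto simp: integral_return)
qed

lemma two_point_moments: "complex_of_real (\<integral>x. x ^ n \<partial>two_point r) = (if even n then complex_of_real r ^ n else 0)"
proof -
  have "complex_of_real (\<integral>x. x ^ n \<partial>two_point r) = (\<integral>x. complex_of_real (x ^ n) \<partial>two_point r)"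
    by (simp only: integral_complex_of_real)
  also have "\<dots> = (complex_of_real (r ^ n) + complex_of_real ((- r) ^ n)) / 2"
    by (rule integral_two_point) simp
  also have "\<dots> = (if even n then complex_of_real r ^ n else 0)"
    by (simp add: power_minus_odd)
  finally show ?thesis .
qed

lemma upper_half_plane_square_ne:
  assumes "w \<in> upper_half_plane"
  shows "w \<noteq> 0" "w\<^sup>2 \<noteq> (complex_of_real r)\<^sup>2"
proof -
  show "w \<noteq> 0" using assms by (auto simp: upper_half_plane_def)
  have "w \<noteq> complex_of_real r" "w \<noteq> - complex_of_real r"
    using assms by (auto simp: upper_half_plane_def)
  then show "w\<^sup>2 \<noteq> (complex_of_real r)\<^sup>2" by (simp only: power2_eq_iff) simp
qed

lemma cauchy_transform_two_point:
  assumes "w \<in> upper_half_plane"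
  shows "cauchy_transform (two_point r) w = w / (w\<^sup>2 - (complex_of_real r)\<^sup>2)"
proof -
  have w: "w - complex_of_real r \<noteq> 0" "w - complex_of_real (- r) \<noteq> 0"
    using assms by (auto simp: upper_half_plane_def complex_eq_iff)
  have "cauchy_transform (two_point r) w = (1 / (w - complex_of_real r) + 1 / (w - complex_of_real (- r))) / 2"
    unfolding cauchy_transform_def by (rule integral_two_point) simp
  also have "\<dots> = w / (w\<^sup>2 - (complex_of_real r)\<^sup>2)"
  proof -
    have "(w - complex_of_real r) * (w - complex_of_real (- r)) = w\<^sup>2 - (complex_of_real r)\<^sup>2"
      "1 * (w - complex_of_real (- r)) + 1 * (w - complex_of_real r) = 2 * w"
      by (simp_all add: algebra_simps power2_eq_square)
    moreover have "(2 * a / b) / 2 = a / b" for a b :: complex by simp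
    ultimately show ?thesis unfolding add_frac_eq[OF w] by (simp only:)
  qed
  finally show ?thesis .
qed

lemma Im_F_transform:
  assumes "real_distribution \<mu>" "0 < Im w" "cauchy_transform \<mu> w \<noteq> 0"
  shows "Im w \<le> Im (F_transform \<mu> w)"
proof -
  interpret real_distribution \<mu> by fact
  let ?f = "\<lambda>x. 1 / (w - complex_of_real x)" and ?G = "cauchy_transform \<mu> w"
  let ?q = "\<integral>x. (cmod (?f x))\<^sup>2 \<partial>\<mu>"
  have cont: "continuous_on UNIV ?f" using assms(2) by (intro resolvent_continuous) simp
  have bound: "cmod (?f x) \<le> 1 / Im w" for x
  proof -
    have "Im w \<le> cmod (w - complex_of_real x)"
      using abs_Im_le_cmod[of "w - complex_of_real x"] assms(2) by simp
    then show ?thesis using assms(2) by (simp add: norm_divide frac_le)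
  qed
  have meas: "g \<in> borel_measurable \<mu>" if "continuous_on UNIV g" for g :: "real \<Rightarrow> 'b::topological_space"
    using borel_measurable_continuous_onI[OF that] by (simp cong: measurable_cong_sets)
  have f: "integrable \<mu> ?f"
    by (rule integrable_const_bound[of _ "1 / Im w"]) (auto simp: bound meas cont)
  have n1: "integrable \<mu> (\<lambda>x. cmod (?f x))" using f by (rule integrable_norm)
  have n2: "integrable \<mu> (\<lambda>x. (cmod (?f x))\<^sup>2)"
    by (rule integrable_const_bound[of _ "(1 / Im w)\<^sup>2"])
      (auto intro!: power_mono bound meas continuous_intros cont simp del: norm_divide)
  have "Im (?f x) = - Im w * (cmod (?f x))\<^sup>2" for x
    by (simp add: Im_divide cmod_power2 norm_divide power_divide)
  then have Im: "Im ?G = - Im w * ?q"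
    unfolding cauchy_transform_def using f by (simp add: integral_Im[symmetric] del: integral_Im)
  have "(cmod ?G)\<^sup>2 \<le> (\<integral>x. cmod (?f x) \<partial>\<mu>)\<^sup>2"
    unfolding cauchy_transform_def by (intro power_mono integral_norm_bound) simp
  also have "\<dots> \<le> ?q"
    using variance_eq[OF n1 n2] variance_positive[of "\<lambda>x. cmod (?f x)"] by simp
  finally have "(cmod ?G)\<^sup>2 \<le> ?q" .
  moreover have "Im (F_transform \<mu> w) = Im w * ?q / (cmod ?G)\<^sup>2"
    by (simp add: F_transform_def Im_divide cmod_power2 Im)
  ultimately show ?thesis
    using assms by (simp add: le_divide_eq)
qed

section \<open>The resolvent of the hermitization\<close>

no_notation fps_nth (infixl "$" 75)

context tracial_algebra begin

lemma Cauchy_Schwarz_adj: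
  assumes "a \<in> M" "b \<in> M"
  shows "(cmod (\<tau> (a * b)))\<^sup>2 \<le> Re (\<tau> (a * adj a)) * Re (\<tau> (adj b * b))"
  using Cauchy_Schwarz[of "adj a" b] assms by (simp add: adj_in adj_adj)

lemma shifted_resolvent:
  assumes S: "S \<in> M" and \<rho>: "supported \<rho> K"
    and moments: "\<And>n. \<tau> ((adj S * S) ^ n) = complex_of_real (\<integral>x. x ^ (2 * n) \<partial>\<rho>)"
    and y: "0 < y" "K < y" "0 \<le> K"
    and R1: "(scalar (complex_of_real (y\<^sup>2)) + adj S * S) * R = 1"
    and R2: "R * (scalar (complex_of_real (y\<^sup>2)) + adj S * S) = 1"
  shows shifted_resolvent_in: "R \<in> M"
    and shifted_resolvent_state: "\<tau> R = complex_of_real (\<integral>x. 1 / (y\<^sup>2 + x\<^sup>2) \<partial>\<rho>)"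
    and shifted_resolvent_offdiag: "cmod (\<tau> (S * R)) \<le> sqrt (Re (\<tau> (S * adj S))) / y\<^sup>2"
proof -
  let ?P = "adj S * S"
  define c where "c = complex_of_real (y\<^sup>2)"
  note R1 = R1[folded c_def] and R2 = R2[folded c_def]
  have P: "?P \<in> M" "adj ?P = ?P" using S by (simp_all add: mult_in adj_in adj_mult adj_adj)
  show R: "R \<in> M"
    by (rule inverse_in[OF _ R1 R2]) (intro add_in scalar_in P)
  have "is_adjoint (scalar c + ?P) (scalar c + ?P)"
    using is_adjoint_add[OF is_adjoint_scalar[of c] is_adjoint_adj[OF P(1)]] P(2) by (simp add: c_def)
  then have "adj ((scalar c + ?P) * R) = adj R * (scalar c + ?P)"
    by (intro adj_eqI is_adjoint_mult is_adjoint_adj R)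
  then have "adj R * (scalar c + ?P) = 1"
    unfolding R1 adj_eqI[OF is_adjoint_1] by (rule sym)
  then have adjR: "adj R = R"
    by (metis R1 mult.assoc mult_1_left mult_1_right)
  have RR: "Re (\<tau> (R * R)) \<le> 1 / y ^ 4"
  proof -
    have "1 = (R * (scalar c + ?P)) * ((scalar c + ?P) * R)" by (simp add: R1 R2)
    also have "\<dots> = scalar (c * c) * (R * R) + scalar (2 * c) * ((R * adj S) * (S * R)) + (R * ?P) * (?P * R)"
    proof -
      have 1: "R * (scalar c * u) = scalar c * (R * u)" "adj S * (scalar c * u) = scalar c * (adj S * u)"
        "S * (scalar c * u) = scalar c * (S * u)" for u
        by (metis mult.assoc scalar_central)+
      have 2: "scalar (2 * c) = scalar c + scalar c"
        by (simp only: mult_2 scalar_add)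
      show ?thesis unfolding 2 unfolding scalar_mult by (simp add: distrib_left distrib_right mult.assoc 1)
    qed
    also have "\<dots> = scalar (c * c) * (R * R) + scalar (2 * c) * (adj (S * R) * (S * R)) + adj (?P * R) * (?P * R)"
      using R S P by (simp add: adj_mult adjR mult_in)
    finally have "\<tau> 1 = \<tau> \<dots>" by simp
    then have "1 = c * c * \<tau> (R * R) + 2 * c * \<tau> (adj (S * R) * (S * R)) + \<tau> (adj (?P * R) * (?P * R))"
      using R S P by (simp add: state_one state_add state_scalar_mult mult_in adj_in add_in scalar_in)
    then have "Re 1 = Re (c * c * \<tau> (R * R) + 2 * c * \<tau> (adj (S * R) * (S * R)) + \<tau> (adj (?P * R) * (?P * R)))"
      by (rule arg_cong)
    then have "1 = y ^ 4 * Re (\<tau> (R * R)) + 2 * y\<^sup>2 * Re (\<tau> (adj (S * R) * (S * R))) + Re (\<tau> (adj (?P * R) * (?P * R)))"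
      by (simp add: c_def power2_eq_square power4_eq_xxxx)
    moreover have "0 \<le> 2 * y\<^sup>2 * Re (\<tau> (adj (S * R) * (S * R)))" "0 \<le> Re (\<tau> (adj (?P * R) * (?P * R)))"
      using R S P by (auto intro!: mult_nonneg_nonneg state_positive[THEN conjunct2] mult_in)
    ultimately have "y ^ 4 * Re (\<tau> (R * R)) \<le> 1" by linarith
    then show ?thesis using y by (simp add: field_simps)
  qed
  have RR0: "0 \<le> Re (\<tau> (R * R))" using state_positive[OF R] by (simp add: adjR)
  show "cmod (\<tau> (S * R)) \<le> sqrt (Re (\<tau> (S * adj S))) / y\<^sup>2"
  proof -
    have nn: "0 \<le> Re (\<tau> (S * adj S))" using state_positive[OF adj_in[OF S]] by (simp add: adj_adj S)
    have "(cmod (\<tau> (S * R)))\<^sup>2 \<le> Re (\<tau> (S * adj S)) * Re (\<tau> (R * R))"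
      using Cauchy_Schwarz_adj[OF S R] by (simp add: adjR)
    also have "\<dots> \<le> Re (\<tau> (S * adj S)) * (1 / y ^ 4)"
      using nn RR by (intro mult_left_mono)
    also have "\<dots> = (sqrt (Re (\<tau> (S * adj S))) / y\<^sup>2)\<^sup>2"
      using nn by (simp add: power_divide flip: power_mult)
    finally show ?thesis
      by (rule power2_le_imp_le) (use nn in simp)
  qed
  define d where "d n = \<tau> (?P ^ n * R)" for n
  define i where "i n = (\<integral>x. x ^ (2 * n) / (y\<^sup>2 + x\<^sup>2) \<partial>\<rho>)" for n
  have pos: "0 < y\<^sup>2 + x\<^sup>2" for x :: real using y by (simp add: add_pos_nonneg)
  have cont: "continuous_on UNIV (\<lambda>x::real. x ^ n / (y\<^sup>2 + x\<^sup>2))" for n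
    using pos by (intro continuous_intros) (metis less_irrefl)
  note int = supported_integrable[OF \<rho> cont]
  have d_Suc: "c * d n + d (Suc n) = \<tau> (?P ^ n)" for n
  proof -
    have "?P ^ n = ?P ^ n * ((scalar c + ?P) * R)" by (simp add: R1)
    also have "\<dots> = scalar c * (?P ^ n * R) + ?P ^ Suc n * R"
    proof -
      have "?P ^ n * (scalar c * R) = scalar c * (?P ^ n * R)"
        by (metis mult.assoc scalar_central)
      then show ?thesis by (simp only: distrib_left distrib_right power_Suc2 mult.assoc)
    qed
    finally have "\<tau> (?P ^ n) = \<tau> \<dots>" by simp
    then show ?thesis
      using P R by (simp only: d_def state_add state_scalar_mult mult_in power_in scalar_in)
  qed
  have i_Suc: "y\<^sup>2 * i n + i (Suc n) = (\<integral>x. x ^ (2 * n) \<partial>\<rho>)" for n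
  proof -
    have "y\<^sup>2 * i n + i (Suc n) = (\<integral>x. y\<^sup>2 * (x ^ (2 * n) / (y\<^sup>2 + x\<^sup>2)) + x ^ (2 * Suc n) / (y\<^sup>2 + x\<^sup>2) \<partial>\<rho>)"
      unfolding i_def by (simp only: Bochner_Integration.integral_add integrable_mult_right int integral_mult_right_zero)
    also have "\<dots> = (\<integral>x. x ^ (2 * n) \<partial>\<rho>)"
    proof (rule Bochner_Integration.integral_cong[OF refl])
      fix x
      have "y\<^sup>2 * (x ^ (2 * n) / (y\<^sup>2 + x\<^sup>2)) + x ^ (2 * Suc n) / (y\<^sup>2 + x\<^sup>2)
          = x ^ (2 * n) * (y\<^sup>2 + x\<^sup>2) / (y\<^sup>2 + x\<^sup>2)"
      proof -
        have "x ^ (2 * Suc n) = x ^ (2 * n) * x\<^sup>2" by (simp add: power2_eq_square)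
        moreover have "y\<^sup>2 * (A / D) + A * x\<^sup>2 / D = A * (y\<^sup>2 + x\<^sup>2) / D" for A D :: real
          by (simp add: add_divide_distrib distrib_left mult.commute)
        ultimately show ?thesis by (simp only:)
      qed
      also have "\<dots> = x ^ (2 * n)"
        using pos[of x] y by auto
      finally show "y\<^sup>2 * (x ^ (2 * n) / (y\<^sup>2 + x\<^sup>2)) + x ^ (2 * Suc n) / (y\<^sup>2 + x\<^sup>2) = x ^ (2 * n)" .
    qed
    finally show ?thesis .
  qed
  \<comment> \<open>\<open>e\<^sub>n\<close> is geometric with ratio \<open>-y\<^sup>2\<close>, yet \<open>O(K\<^sup>2\<^sup>n)\<close> with \<open>K < y\<close>, hence zero\<close>
  define e where "e n = d n - complex_of_real (i n)" for n
  have "e (Suc n) = - c * e n" for n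
  proof -
    have "c * d n + d (Suc n) = complex_of_real (y\<^sup>2 * i n + i (Suc n))"
      using d_Suc i_Suc moments by (simp only:)
    then show ?thesis by (simp add: e_def c_def algebra_simps)
  qed
  then have e_n: "e n = (- c) ^ n * e 0" for n
    by (induct n) simp_all
  have "cmod (d n) \<le> K ^ (2 * n) / y\<^sup>2" for n
  proof -
    have adjPn: "adj (?P ^ n) = ?P ^ n"
      using is_adjoint_power[OF is_adjoint_adj[OF P(1)], of n] P(2) by (simp add: adj_eqI)
    have "(cmod (d n))\<^sup>2 \<le> Re (\<tau> (?P ^ n * ?P ^ n)) * Re (\<tau> (R * R))"
      using Cauchy_Schwarz_adj[OF power_in[OF P(1), of n] R] by (simp add: d_def adjR adjPn)
    also have "\<tau> (?P ^ n * ?P ^ n) = complex_of_real (\<integral>x. x ^ (2 * (2 * n)) \<partial>\<rho>)"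
      using moments[of "2 * n"] by (simp add: mult_2 power_add)
    also have "Re (complex_of_real (\<integral>x. x ^ (2 * (2 * n)) \<partial>\<rho>)) * Re (\<tau> (R * R)) \<le> K ^ (2 * (2 * n)) * (1 / y ^ 4)"
    proof (rule mult_mono[OF _ RR _ RR0])
      have "\<bar>\<integral>x. x ^ (2 * (2 * n)) \<partial>\<rho>\<bar> \<le> K ^ (2 * (2 * n))"
        by (rule supported_integral_bound[OF \<rho>]) (auto intro!: continuous_intros power_mono simp: power_abs simp flip: power_mult)
      then show "Re (complex_of_real (\<integral>x. x ^ (2 * (2 * n)) \<partial>\<rho>)) \<le> K ^ (2 * (2 * n))" by simp
    qed (use y in simp)
    also have "\<dots> = (K ^ (2 * n) / y\<^sup>2)\<^sup>2"
      by (simp add: power_divide ac_simps flip: power_mult)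
    finally show ?thesis
      by (rule power2_le_imp_le) (use y in simp)
  qed
  moreover have "\<bar>i n\<bar> \<le> K ^ (2 * n) / y\<^sup>2" for n
    unfolding i_def
  proof (rule supported_integral_bound[OF \<rho> cont])
    fix x :: real assume "\<bar>x\<bar> \<le> K"
    then have "\<bar>x\<bar> ^ (2 * n) \<le> K ^ (2 * n)" by (intro power_mono) auto
    then show "\<bar>x ^ (2 * n) / (y\<^sup>2 + x\<^sup>2)\<bar> \<le> K ^ (2 * n) / y\<^sup>2"
      using pos[of x] y by (auto simp: abs_divide power_abs intro!: frac_le)
  qed
  ultimately have e_bound: "cmod (e n) \<le> 2 * (K ^ (2 * n) / y\<^sup>2)" for n
    using norm_triangle_ineq4[of "d n" "complex_of_real (i n)"] unfolding e_def
    by (smt (verit) norm_of_real)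
  have "cmod (e n) = y ^ (2 * n) * cmod (e 0)" for n
    unfolding e_n[of n] by (simp add: c_def norm_mult norm_power power_mult)
  with e_bound have "y ^ (2 * n) * cmod (e 0) \<le> 2 * (K ^ (2 * n) / y\<^sup>2)" for n
    by metis
  then have "cmod (e 0) \<le> 2 / y\<^sup>2 * ((K / y)\<^sup>2) ^ n" for n
    using y by (simp add: field_simps power_divide flip: power_mult)
  moreover have "(\<lambda>n. 2 / y\<^sup>2 * ((K / y)\<^sup>2) ^ n) \<longlonglongrightarrow> 2 / y\<^sup>2 * 0"
  proof (intro tendsto_mult_left LIMSEQ_power_zero)
    have "(K / y)\<^sup>2 < 1" using y by (simp add: power_less_one_iff abs_square_less_1)
    then show "norm ((K / y)\<^sup>2) < 1" by simp
  qed
  ultimately have "cmod (e 0) \<le> 0"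
    using LIMSEQ_le_const by fastforce
  then show "\<tau> R = complex_of_real (\<integral>x. 1 / (y\<^sup>2 + x\<^sup>2) \<partial>\<rho>)"
    by (simp add: e_def d_def i_def)
qed

end

lemma mat2_nth [simp]:
  "mat2 a b c d $ 1 $ 1 = a" "mat2 a b c d $ 1 $ 2 = b"
  "mat2 a b c d $ 2 $ 1 = c" "mat2 a b c d $ 2 $ 2 = d"
  by (simp_all add: mat2_def)

lemma mat2_eqI:
  fixes A B :: "'a ^ 2 ^ 2"
  assumes "A $ 1 $ 1 = B $ 1 $ 1" "A $ 1 $ 2 = B $ 1 $ 2" "A $ 2 $ 1 = B $ 2 $ 1" "A $ 2 $ 2 = B $ 2 $ 2"
  shows "A = B"
proof -
  have "A $ i $ j = B $ i $ j" for i j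
    using exhaust_2[of i] exhaust_2[of j] assms by auto
  then show ?thesis by (simp add: vec_eq_iff)
qed

lemma mat2_mult: "mat2 a b c d ** mat2 a' b' c' d' =
    mat2 (a * a' + b * c') (a * b' + b * d') (c * a' + d * c') (c * b' + d * (d' :: 'a::semiring_1))"
  by (rule mat2_eqI) (simp_all add: matrix_matrix_mult_def sum_2)

lemma mat_mat2: "(mat x :: 'a::zero ^ 2 ^ 2) = mat2 x 0 0 x"
  by (rule mat2_eqI) (simp_all add: mat_def)

lemma matrix_inv_eqI:
  fixes A B :: "'a::semiring_1 ^ 'n ^ 'n"
  assumes "A ** B = mat 1" "B ** A = mat 1"
  shows "matrix_inv A = B"
proof -
  have "\<exists>A'. A ** A' = mat 1 \<and> A' ** A = mat 1" using assms by blast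
  then have "A ** matrix_inv A = mat 1 \<and> matrix_inv A ** A = mat 1"
    unfolding matrix_inv_def by (rule someI_ex)
  then show ?thesis
    by (metis assms(1) matrix_mul_assoc matrix_mul_lid matrix_mul_rid)
qed

lemma (in tracial_algebra) hermitization_resolvent:
  assumes T: "T \<in> M" and S_def: "S = T - scalar lam" and y: "0 < y"
    and R: "R \<in> M" and R1: "(scalar (complex_of_real (y\<^sup>2)) + adj S * S) * R = 1"
    and R2: "R * (scalar (complex_of_real (y\<^sup>2)) + adj S * S) = 1"
  shows "map_matrix \<tau> (matrix_inv
      (map_matrix scalar (mat (\<i> * complex_of_real y) + mat2 0 lam (cnj lam) 0) - mat2 0 T (adj T) 0))
    = mat2 (- \<i> * complex_of_real y * \<tau> R) (- \<tau> (S * R)) (- \<tau> (R * adj S)) (- \<i> * complex_of_real y * \<tau> R)"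
proof -
  let ?z = "\<i> * complex_of_real y" and ?c = "complex_of_real (y\<^sup>2)"
  have S: "S \<in> M" using T S_def by (simp add: diff_in scalar_in)
  have A: "map_matrix scalar (mat ?z + mat2 0 lam (cnj lam) 0) - mat2 0 T (adj T) 0
      = mat2 (scalar ?z) (- S) (- adj S) (scalar ?z)"
    by (rule mat2_eqI) (simp_all add: mat_mat2 map_matrix_def scalar_0 S_def adj_diff_scalar T)
  let ?w = "- \<i> / complex_of_real y"
  let ?B = "mat2 (scalar ?w * (1 - S * R * adj S)) (- (S * R)) (- (R * adj S)) (scalar (- ?z) * R)"
  have zw: "?z * ?w = 1" "?z * - ?z = ?c" "?w * ?c = - ?z"
    using y by (simp, simp add: power2_eq_square complex_eq_iff, simp add: power2_eq_square)
  have comm: "u * (scalar d * v) = scalar d * (u * v)" for u v :: "'h bop" and d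
    by (metis mult.assoc scalar_central)
  have combine: "scalar u * (scalar v * x) = scalar (u * v) * x" for u v and x :: "'h bop"
    by (simp add: scalar_mult mult.assoc)
  have c1: "1 - adj S * (S * R) = scalar ?c * R"
    using R1 by (simp add: distrib_right mult.assoc eq_diff_eq[symmetric])
  have c2: "1 - R * (adj S * S) = scalar ?c * R"
    using R2 by (simp add: distrib_left scalar_central[of _ R] eq_diff_eq[symmetric])
  have k1: "adj S * (scalar ?w * (1 - S * R * adj S)) = scalar (- ?z) * (R * adj S)"
  proof -
    have "adj S * (scalar ?w * (1 - S * R * adj S)) = scalar ?w * ((1 - adj S * (S * R)) * adj S)"
      unfolding comm[of "adj S"] by (simp add: algebra_simps)
    then show ?thesis unfolding c1 mult.assoc combine zw .
  qed
  have k2: "scalar ?w * (1 - S * R * adj S) * S = scalar (- ?z) * (S * R)"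
  proof -
    have "scalar ?w * (1 - S * R * adj S) * S = scalar ?w * (S * (1 - R * (adj S * S)))"
      by (simp add: algebra_simps)
    then show ?thesis unfolding c2 comm[of S] combine zw .
  qed
  have k3: "adj S * (S * R) + scalar ?c * R = 1"
    unfolding c1[symmetric] by simp
  have k3': "R * (adj S * S) + scalar ?c * R = 1"
    unfolding c2[symmetric] by simp
  have k4: "scalar ?z * (scalar ?w * x) = x" for x :: "'h bop"
    unfolding combine zw by (simp add: scalar_1)
  have "mat2 (scalar ?z) (- S) (- adj S) (scalar ?z) ** ?B = mat 1"
  proof -
    have "scalar ?z * (scalar ?w * (1 - S * R * adj S)) + - S * - (R * adj S) = 1"
      unfolding k4 by (simp add: mult.assoc)
    moreover have "scalar ?z * - (S * R) + - S * (scalar (- ?z) * R) = 0"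
      unfolding comm[of "- S"] by (simp add: scalar_minus)
    moreover have "- adj S * (scalar ?w * (1 - S * R * adj S)) + scalar ?z * - (R * adj S) = 0"
      unfolding mult_minus_left k1 by (simp add: scalar_minus)
    moreover have "- adj S * - (S * R) + scalar ?z * (scalar (- ?z) * R) = 1"
      unfolding combine zw using k3 by simp
    ultimately show ?thesis unfolding mat2_mult mat_mat2 by (simp only:)
  qed
  moreover have "?B ** mat2 (scalar ?z) (- S) (- adj S) (scalar ?z) = mat 1"
  proof -
    have "scalar ?w * (1 - S * R * adj S) * scalar ?z + - (S * R) * - adj S = 1"
      unfolding scalar_central[of ?z, symmetric] k4 by simp
    moreover have "scalar ?w * (1 - S * R * adj S) * - S + - (S * R) * scalar ?z = 0"
      unfolding mult_minus_right k2 scalar_central[of ?z, symmetric] by (simp add: scalar_minus)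
    moreover have "- (R * adj S) * scalar ?z + scalar (- ?z) * R * - adj S = 0"
      unfolding scalar_central[of ?z, symmetric] by (simp add: scalar_minus mult.assoc)
    moreover have "- (R * adj S) * - S + scalar (- ?z) * R * scalar ?z = 1"
      unfolding scalar_central[of ?z, symmetric] combine zw using k3' by (simp add: mult.assoc)
    ultimately show ?thesis unfolding mat2_mult mat_mat2 by (simp only:)
  qed
  ultimately have inv: "matrix_inv (mat2 (scalar ?z) (- S) (- adj S) (scalar ?z)) = ?B"
    by (rule matrix_inv_eqI)
  have in_M: "S * R \<in> M" "R * adj S \<in> M" "adj S * S \<in> M" "S * R * adj S \<in> M" "R * (adj S * S) \<in> M"
    using S R by (auto intro!: mult_in adj_in)
  have "\<tau> (scalar ?c * R) = \<tau> (1 - R * (adj S * S))" by (simp only: c2)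
  then have tr: "?c * \<tau> R = 1 - \<tau> (R * (adj S * S))"
    using R in_M by (simp only: state_scalar_mult state_diff one_in state_one)
  have "\<tau> (S * R * adj S) = \<tau> (R * (adj S * S))"
    using state_commute[of S "R * adj S"] S R in_M by (simp add: mult.assoc)
  then have "\<tau> (scalar ?w * (1 - S * R * adj S)) = ?w * (?c * \<tau> R)"
    using in_M by (simp only: tr state_scalar_mult state_diff one_in state_one diff_in)
  also have "\<dots> = - ?z * \<tau> R"
    using zw(3) by (simp only: mult.assoc[symmetric])
  finally have t1: "\<tau> (scalar ?w * (1 - S * R * adj S)) = - ?z * \<tau> R" .
  show ?thesis
    unfolding A inv
    by (rule mat2_eqI) (use R in_M t1 in \<open>simp_all add: map_matrix_def state_uminus state_scalar_mult\<close>)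
qed

section \<open>Comparison of the subordination functions\<close>

lemma upper_half_plane_identity:
  assumes "f holomorphic_on upper_half_plane" "g holomorphic_on upper_half_plane"
    and eq: "\<And>y. Y < y \<Longrightarrow> f (\<i> * complex_of_real y) = g (\<i> * complex_of_real y)"
    and z: "z \<in> upper_half_plane"
  shows "f z = g z"
proof -
  define c where "c = max Y 0"
  let ?U = "(\<lambda>y. \<i> * complex_of_real y) ` {c<..}" and ?\<xi> = "\<i> * complex_of_real (c + 1)"
  have "f z - g z = 0"
  proof (rule analytic_continuation[where f = "\<lambda>z. f z - g z" and S = upper_half_plane and U = ?U and \<xi> = ?\<xi>])
    show "open upper_half_plane" "connected upper_half_plane"
      unfolding upper_half_plane_def
      by (rule open_halfspace_Im_gt, intro convex_connected convex_halfspace_Im_gt)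
    show "?U \<subseteq> upper_half_plane" "?\<xi> \<in> upper_half_plane"
      by (auto simp: upper_half_plane_def c_def)
    show "?\<xi> islimpt ?U"
      unfolding islimpt_approachable
    proof (intro allI impI)
      fix e :: real assume "0 < e"
      then show "\<exists>x'\<in>?U. x' \<noteq> ?\<xi> \<and> dist x' ?\<xi> < e"
        by (intro bexI[of _ "\<i> * complex_of_real (c + 1 + e / 2)"])
          (auto simp: dist_norm norm_mult simp flip: of_real_add of_real_diff right_diff_distrib)
    qed
    show "(\<lambda>z. f z - g z) holomorphic_on upper_half_plane"
      using assms by (intro holomorphic_intros)
    show "f z - g z = 0" if "z \<in> ?U" for z using that eq by (auto simp: c_def)
  qed (use z in simp)
  then show ?thesis by simp
qed

lemma two_point_transform_eq:
  assumes "w \<in> upper_half_plane" "w' \<in> upper_half_plane"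
    and "w / (w\<^sup>2 - (complex_of_real r)\<^sup>2) = w' / (w'\<^sup>2 - (complex_of_real r)\<^sup>2)"
  shows "w = w' \<or> w * w' = - (complex_of_real r)\<^sup>2"
proof -
  have "w * (w'\<^sup>2 - (complex_of_real r)\<^sup>2) = w' * (w\<^sup>2 - (complex_of_real r)\<^sup>2)"
    using assms(3) upper_half_plane_square_ne(2)[OF assms(1), of r] upper_half_plane_square_ne(2)[OF assms(2), of r]
    by (simp add: frac_eq_eq)
  then have "(w' - w) * (w * w' + (complex_of_real r)\<^sup>2) = 0"
    by (simp add: algebra_simps power2_eq_square)
  then show ?thesis by (auto simp: add_eq_0_iff2)
qed

lemma upper_half_plane_mult_ne:
  assumes "w \<in> upper_half_plane" "w' \<in> upper_half_plane"
  shows "w * w' \<noteq> complex_of_real (r\<^sup>2)"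
proof
  assume "w * w' = complex_of_real (r\<^sup>2)"
  then have "w' * complex_of_real ((cmod w)\<^sup>2) = complex_of_real (r\<^sup>2) * cnj w"
    unfolding complex_norm_square by (simp add: mult.commute mult.left_commute)
  moreover have "Im (x * complex_of_real a) = Im x * a" "Im (complex_of_real a * cnj x) = - (a * Im x)" for x a
    by simp_all
  ultimately have "Im w' * (cmod w)\<^sup>2 = - (r\<^sup>2 * Im w)"
    by metis
  moreover have "0 < Im w' * (cmod w)\<^sup>2" "0 \<le> r\<^sup>2 * Im w"
    using assms by (auto simp: upper_half_plane_def intro!: mult_pos_pos)
  ultimately show False by linarith
qed

lemma diag_analytic_holomorphic:
  fixes \<Omega> :: "complex ^ 2 ^ 2 \<Rightarrow> complex ^ 2 ^ 2"
  assumes "diag_analytic \<Omega>"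
  shows "(\<lambda>z. \<Omega> (mat z) $ 1 $ 1) holomorphic_on upper_half_plane"
  unfolding holomorphic_on_def field_differentiable_def
proof
  let ?m = "mat :: complex \<Rightarrow> complex ^ 2 ^ 2"
  fix z assume z: "z \<in> upper_half_plane"
  have sub: "?m ` upper_half_plane \<subseteq> diag_upper_half_plane"
    by (auto simp: diag_upper_half_plane_def upper_half_plane_def mat_mat2)
  then obtain L where L: "(\<Omega> has_derivative L) (at (?m z) within diag_upper_half_plane)"
    and lin: "\<And>c A. L (mat c ** A) = mat c ** L A"
    using assms z unfolding diag_analytic_def by blast
  have "linear ?m"
    by (rule linearI; rule mat2_eqI) (simp_all add: mat_mat2)
  then have "(?m has_derivative ?m) (at z within upper_half_plane)"
    by (simp add: linear_conv_bounded_linear bounded_linear_imp_has_derivative)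
  then have "((\<lambda>z. \<Omega> (?m z)) has_derivative (\<lambda>h. L (?m h))) (at z within upper_half_plane)"
    by (rule has_derivative_in_compose) (rule has_derivative_subset[OF L sub])
  then have "((\<lambda>z. \<Omega> (?m z) $ 1 $ 1) has_derivative (\<lambda>h. L (?m h) $ 1 $ 1)) (at z within upper_half_plane)"
    by (intro bounded_linear.has_derivative[OF bounded_linear_vec_nth])
  moreover have "(\<lambda>h. L (?m h) $ 1 $ 1) = (*) (L (mat 1) $ 1 $ 1)"
  proof -
    have "(?m h ** X) $ 1 $ 1 = X $ 1 $ 1 * h" for h X
      unfolding mat_mat2 by (simp add: matrix_matrix_mult_def sum_2)
    moreover have "L (?m h) = ?m h ** L (mat 1)" for h
      using lin[of h "mat 1"] unfolding matrix_mul_rid .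
    ultimately have "L (?m h) $ 1 $ 1 = L (mat 1) $ 1 $ 1 * h" for h by metis
    then show ?thesis by (rule ext)
  qed
  ultimately show "\<exists>f'. ((\<lambda>z. \<Omega> (?m z) $ 1 $ 1) has_field_derivative f') (at z within upper_half_plane)"
    unfolding has_field_derivative_def by auto
qed

lemma subordination_entries:
  fixes b :: "complex ^ 2 ^ 2"
  assumes "b \<in> diag_upper_half_plane"
    and "mat2 g u v g = matrix_inv (b + mat2 0 lam (cnj lam) 0)"
  defines "w \<equiv> b $ 1 $ 1"
  shows "g = w / (w\<^sup>2 - (complex_of_real (cmod lam))\<^sup>2)"
    and "u = - lam / (w\<^sup>2 - (complex_of_real (cmod lam))\<^sup>2)"
proof -
  define w' where "w' = b $ 2 $ 2"
  have w: "w \<in> upper_half_plane" "w' \<in> upper_half_plane"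
    using assms(1) by (auto simp: w_def w'_def diag_upper_half_plane_def upper_half_plane_def)
  have b: "b + mat2 0 lam (cnj lam) 0 = mat2 w lam (cnj lam) w'"
    using assms(1) by (intro mat2_eqI) (auto simp: w_def w'_def diag_upper_half_plane_def)
  define d where "d = w * w' - lam * cnj lam"
  have d: "d \<noteq> 0"
    using upper_half_plane_mult_ne[OF w, of "cmod lam"] unfolding d_def complex_norm_square by simp
  have inv: "matrix_inv (mat2 w lam (cnj lam) w') = mat2 (w' / d) (- lam / d) (- cnj lam / d) (w / d)"
    using d by (intro matrix_inv_eqI; unfold mat2_mult mat_mat2; intro mat2_eqI)
      (simp_all add: divide_simps, simp_all add: d_def algebra_simps)
  have eq: "mat2 g u v g = mat2 (w' / d) (- lam / d) (- cnj lam / d) (w / d)"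
    using assms(2) unfolding b inv .
  have g: "g = w' / d" "g = w / d" "u = - lam / d"
    using arg_cong[OF eq, of "\<lambda>A :: complex ^ 2 ^ 2. A $ 1 $ 1"] arg_cong[OF eq, of "\<lambda>A :: complex ^ 2 ^ 2. A $ 2 $ 2"]
      arg_cong[OF eq, of "\<lambda>A :: complex ^ 2 ^ 2. A $ 1 $ 2"] by simp_all
  then have "w' = w" using d by simp
  then have "d = w\<^sup>2 - (complex_of_real (cmod lam))\<^sup>2"
    unfolding d_def of_real_power[symmetric] complex_norm_square by (simp add: power2_eq_square)
  then show "g = w / (w\<^sup>2 - (complex_of_real (cmod lam))\<^sup>2)"
    "u = - lam / (w\<^sup>2 - (complex_of_real (cmod lam))\<^sup>2)" using g by simp_all
qed

lemma spectral_distribution_supported: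
  assumes "spectral_distribution \<tau> a \<sigma>"
  obtains K where "supported \<sigma> K" "0 \<le> K"
proof -
  obtain r where "supported \<sigma> r" using assms unfolding spectral_distribution_def by (blast intro: supportedI)
  then have "supported \<sigma> (max r 0)" by (rule supported_mono) simp
  then show thesis using that by simp
qed

lemma modulus_distribution_moments:
  assumes "modulus_distribution \<tau> x \<sigma>"
  shows "\<tau> ((adj x * x) ^ n) = complex_of_real (\<integral>x. x ^ (2 * n) \<partial>\<sigma>)"
proof -
  obtain a where a: "a * a = adj x * x" "spectral_distribution \<tau> a \<sigma>"
    using assms unfolding modulus_distribution_def is_modulus_def by blast
  have "a ^ (2 * n) = (adj x * x) ^ n" by (simp add: power_mult power2_eq_square a(1))
  then show ?thesis using a(2) unfolding spectral_distribution_def by metis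
qed

lemma modulus_distribution_supported:
  assumes "modulus_distribution \<tau> x \<sigma>"
  obtains K where "supported \<sigma> K" "0 \<le> K"
  using assms spectral_distribution_supported unfolding modulus_distribution_def by metis

lemma (in tracial_algebra) two_point_square:
  assumes b: "b \<in> M" and "spectral_distribution \<tau> b (two_point r)"
  shows "b * b = scalar (complex_of_real (r\<^sup>2))" and "\<tau> b = 0"
proof -
  let ?c = "complex_of_real (r\<^sup>2)"
  have sa: "is_adjoint b b" and moment: "\<tau> (b ^ n) = (if even n then complex_of_real r ^ n else 0)" for n
    using assms(2) two_point_moments unfolding spectral_distribution_def by metis+
  show "\<tau> b = 0" using moment[of 1] by simp
  let ?d = "b * b - scalar ?c"
  have "is_adjoint ?d ?d"
    using is_adjoint_diff[OF is_adjoint_mult[OF sa sa] is_adjoint_scalar[of ?c]] by simp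
  then have "adj ?d * ?d = b ^ 4 - scalar (2 * ?c) * (b ^ 2) + scalar (?c * ?c)"
  proof -
    define C :: "'h bop" where "C = scalar ?c"
    have "b * (b * C) = C * (b * b)"
      unfolding C_def by (metis mult.assoc scalar_central)
    moreover have e: "scalar (2 * ?c) = C + C" "scalar (?c * ?c) = C * C"
      unfolding C_def by (simp_all only: mult_2 scalar_add scalar_mult)
    ultimately show ?thesis
      unfolding adj_eqI[OF \<open>is_adjoint ?d ?d\<close>] e unfolding C_def[symmetric]
      by (simp add: algebra_simps power2_eq_square power4_eq_xxxx)
  qed
  then have "\<tau> (adj ?d * ?d) = \<tau> (b ^ 4) - 2 * ?c * \<tau> (b ^ 2) + ?c * ?c"
    using b by (simp only: state_add state_diff state_scalar_mult state_scalar power_in mult_in scalar_in diff_in)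
  also have "\<dots> = 0"
    by (simp only: moment) (simp add: power2_eq_square power4_eq_xxxx)
  finally have "?d = 0"
    by (intro state_faithful diff_in mult_in scalar_in b)
  then show "b * b = scalar ?c" by simp
qed

lemma shifted_convolution_transform:
  fixes M :: "('h::chilbert_space) bop set"
  assumes M: "tracial_vn_algebra M \<tau>" "T \<in> M" "R_diagonal TYPE('k::chilbert_space) \<tau> T"
    and \<rho>: "modulus_distribution \<tau> T \<rho>" and \<rho>': "modulus_distribution \<tau> (T - scalar lam) \<rho>'"
    and conv: "free_additive_convolution TYPE('l::chilbert_space) (symmetrization \<rho>) (two_point (cmod lam)) \<sigma>"
    and z: "Im z \<noteq> 0"
  shows "cauchy_transform (symmetrization \<rho>') z = cauchy_transform \<sigma> z"
proof -
  obtain N :: "'l bop set" and \<phi> a b where N: "tracial_vn_algebra N \<phi>" "a \<in> N" "b \<in> N"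
    "star_free \<phi> a b" "spectral_distribution \<phi> a (symmetrization \<rho>)"
    "spectral_distribution \<phi> b (two_point (cmod lam))" "spectral_distribution \<phi> (a + b) \<sigma>"
    using conv unfolding free_additive_convolution_def by blast
  interpret M: tracial_algebra M \<tau> by unfold_locales fact
  interpret N: tracial_algebra N \<phi> by unfold_locales fact
  obtain K where K: "supported \<rho> K" using modulus_distribution_supported[OF \<rho>] by blast
  obtain K' where K': "supported \<rho>' K'" using modulus_distribution_supported[OF \<rho>'] by blast
  obtain L where L: "supported \<sigma> L" using spectral_distribution_supported[OF N(7)] by blast
  have sym: "complex_of_real (\<integral>x. x ^ n \<partial>symmetrization \<rho>1)
      = (if even n then \<tau> ((adj x * x) ^ (n div 2)) else 0)"
    if "supported \<rho>1 r" "modulus_distribution \<tau> x \<rho>1" for n x r \<rho>1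
    using symmetrization_moments[OF that(1), of n] modulus_distribution_moments[OF that(2), of "n div 2"]
    by (auto simp: dvd_mult_div_cancel)
  have "\<phi> (a ^ n) = (if even n then \<tau> ((adj T * T) ^ (n div 2)) else 0)" for n
    using N(5) sym[OF K \<rho>] unfolding spectral_distribution_def by metis
  then have "\<phi> ((a + b) ^ n) = (if even n then
      \<tau> ((adj (T - scalar lam) * (T - scalar lam)) ^ (n div 2)) else 0)" for n
    by (rule free_shift_moments[OF M.tracial_algebra_axioms M(2,3) N.tracial_algebra_axioms N(2-4)
        N.two_point_square[OF N(3,6)]])
  then have "complex_of_real (\<integral>x. x ^ n \<partial>symmetrization \<rho>') = complex_of_real (\<integral>x. x ^ n \<partial>\<sigma>)" for n
    using N(7) sym[OF K' \<rho>'] unfolding spectral_distribution_def by metis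
  then have "(\<integral>x. x ^ n \<partial>symmetrization \<rho>') = (\<integral>x. x ^ n \<partial>\<sigma>)" for n
    by (simp only: of_real_eq_iff)
  then show ?thesis
    using supported_symmetrization[OF K'] L z
    by (intro cauchy_transform_eqI[of _ "max K' L"]) (auto intro: supported_mono)
qed

lemma subordination_Im_ge:
  assumes "scalar_subordination \<mu> (two_point r) \<sigma> \<omega>\<^sub>1 \<omega>\<^sub>2" "real_distribution \<mu>" "z \<in> upper_half_plane"
  shows "Im z \<le> Im (\<omega>\<^sub>2 z)"
proof -
  have \<omega>: "\<omega>\<^sub>1 z \<in> upper_half_plane" "\<omega>\<^sub>2 z \<in> upper_half_plane" "F_transform \<mu> (\<omega>\<^sub>1 z) = F_transform \<sigma> z"
    "F_transform (two_point r) (\<omega>\<^sub>2 z) = F_transform \<sigma> z" "\<omega>\<^sub>1 z + \<omega>\<^sub>2 z = z + F_transform \<sigma> z"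
    using assms(1,3) unfolding scalar_subordination_def by blast+
  have "F_transform (two_point r) (\<omega>\<^sub>2 z) \<noteq> 0"
    using upper_half_plane_square_ne(1)[OF \<omega>(2)] upper_half_plane_square_ne(2)[OF \<omega>(2), of r]
    unfolding F_transform_def cauchy_transform_two_point[OF \<omega>(2)] by simp
  then have "F_transform \<mu> (\<omega>\<^sub>1 z) \<noteq> 0"
    unfolding \<omega>(3,4) .
  then have "cauchy_transform \<mu> (\<omega>\<^sub>1 z) \<noteq> 0"
    unfolding F_transform_def by simp
  then have "Im (\<omega>\<^sub>1 z) \<le> Im (F_transform \<sigma> z)"
    using Im_F_transform[OF assms(2), of "\<omega>\<^sub>1 z"] \<omega>(1) unfolding \<omega>(3) by (simp add: upper_half_plane_def)
  then show ?thesis using arg_cong[OF \<omega>(5), of Im] by simp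
qed

lemma two_point_subordination_symmetric:
  assumes hol: "\<omega> holomorphic_on upper_half_plane"
    and half_plane: "\<And>z. z \<in> upper_half_plane \<Longrightarrow> \<omega> z \<in> upper_half_plane"
    and Im_ge: "\<And>z. z \<in> upper_half_plane \<Longrightarrow> Im z \<le> Im (\<omega> z)"
    and imaginary: "\<And>y. 0 < y \<Longrightarrow> \<exists>t. cauchy_transform (two_point r) (\<omega> (\<i> * complex_of_real y)) = \<i> * complex_of_real t"
    and y: "0 < y"
  shows "Re (\<omega> (\<i> * complex_of_real y)) = 0"
proof -
  let ?f = "\<lambda>z. - cnj (\<omega> (- cnj z))"
  have i_in: "\<i> * complex_of_real s \<in> upper_half_plane" if "0 < s" for s
    using that by (simp add: upper_half_plane_def)
  have img: "cnj ` upper_half_plane = {z. Im z < 0}"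
    unfolding image_cnj_conv_vimage_cnj by (auto simp: upper_half_plane_def)
  have "\<omega> \<circ> uminus holomorphic_on {z. Im z < 0}"
    by (rule holomorphic_on_compose_gen[OF holomorphic_on_minus[OF holomorphic_on_ident] hol])
      (auto simp: upper_half_plane_def)
  then have "cnj \<circ> (\<omega> \<circ> uminus) \<circ> cnj holomorphic_on upper_half_plane"
    by (intro holomorphic_on_compose_cnj_cnj)
      (simp_all only: img, simp add: upper_half_plane_def open_halfspace_Im_gt)
  then have f: "?f holomorphic_on upper_half_plane"
    by (intro holomorphic_on_minus) (simp add: o_def)
  have "?f (\<i> * complex_of_real s) = \<omega> (\<i> * complex_of_real s)" if s: "max 0 \<bar>r\<bar> < s" for s
  proof -
    let ?w = "\<omega> (\<i> * complex_of_real s)"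
    have w: "?w \<in> upper_half_plane" using half_plane i_in s by simp
    have w': "- cnj ?w \<in> upper_half_plane" using w by (simp add: upper_half_plane_def)
    have "0 < s" using s by simp
    then obtain t where t: "?w / (?w\<^sup>2 - (complex_of_real r)\<^sup>2) = \<i> * complex_of_real t"
      using imaginary[of s] unfolding cauchy_transform_two_point[OF w] by blast
    have "(- cnj ?w) / ((- cnj ?w)\<^sup>2 - (complex_of_real r)\<^sup>2) = - cnj (?w / (?w\<^sup>2 - (complex_of_real r)\<^sup>2))"
      by simp
    also have "\<dots> = ?w / (?w\<^sup>2 - (complex_of_real r)\<^sup>2)"
      unfolding t by simp
    finally consider "- cnj ?w = ?w" | "- cnj ?w * ?w = - (complex_of_real r)\<^sup>2"
      using two_point_transform_eq[OF w' w] by blast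
    then show ?thesis
    proof cases
      case 1
      then show ?thesis by simp
    next
      case 2
      have "complex_of_real ((cmod ?w)\<^sup>2) = complex_of_real (r\<^sup>2)"
        using 2 unfolding complex_norm_square by (simp add: mult.commute)
      then have "(cmod ?w)\<^sup>2 = r\<^sup>2" by (simp only: of_real_eq_iff)
      then have "cmod ?w = \<bar>r\<bar>" by (metis norm_ge_zero abs_of_nonneg power2_eq_iff_nonneg abs_ge_zero power2_abs)
      moreover have "s \<le> cmod ?w"
        using Im_ge[OF i_in, of s] \<open>0 < s\<close> abs_Im_le_cmod[of ?w] by simp
      ultimately show ?thesis using s by simp
    qed
  qed
  then have "?f (\<i> * complex_of_real y) = \<omega> (\<i> * complex_of_real y)"
    by (rule upper_half_plane_identity[OF f hol _ i_in[OF y]])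
  then show ?thesis by (simp add: complex_eq_iff)
qed

lemma operator_subordination_resolvent:
  fixes \<Omega> :: "complex ^ 2 ^ 2 \<Rightarrow> complex ^ 2 ^ 2"
  assumes M: "tracial_vn_algebra M \<tau>" "T \<in> M" and sub: "operator_subordination \<tau> T lam \<Omega>"
    and \<rho>': "modulus_distribution \<tau> (T - scalar lam) \<rho>'"
  obtains Y C where "\<And>y. Y < y \<Longrightarrow> 0 < y \<Longrightarrow>
      cauchy_transform (symmetrization \<rho>') (\<i> * complex_of_real y) =
        cauchy_transform (two_point (cmod lam)) (\<Omega> (mat (\<i> * complex_of_real y)) $ 1 $ 1) \<and>
      cmod (lam / ((\<Omega> (mat (\<i> * complex_of_real y)) $ 1 $ 1)\<^sup>2 - (complex_of_real (cmod lam))\<^sup>2)) \<le> C / y\<^sup>2"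
proof -
  interpret M: tracial_algebra M \<tau> by unfold_locales fact
  define S where "S = T - scalar lam"
  have S: "S \<in> M" using M(2) by (simp add: S_def M.diff_in M.scalar_in)
  obtain K where K: "supported \<rho>' K" "0 \<le> K" using modulus_distribution_supported[OF \<rho>'] .
  obtain Y where Y: "\<And>y. Y < y \<Longrightarrow> \<exists>R. (scalar (complex_of_real (y\<^sup>2)) + adj S * S) * R = 1
      \<and> R * (scalar (complex_of_real (y\<^sup>2)) + adj S * S) = 1"
    using bop_scalar_plus_invertible by blast
  show thesis
  proof (rule that[of "max Y K" "sqrt (Re (\<tau> (S * adj S)))"])
    fix y assume "max Y K < y" and y: "0 < y"
    then have y': "Y < y" "K < y" by auto
    let ?b = "mat (\<i> * complex_of_real y) :: complex ^ 2 ^ 2"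
    let ?w = "\<Omega> ?b $ 1 $ 1"
    obtain R where R: "(scalar (complex_of_real (y\<^sup>2)) + adj S * S) * R = 1"
      "R * (scalar (complex_of_real (y\<^sup>2)) + adj S * S) = 1" using Y[OF y'(1)] by blast
    note res = S K(1) modulus_distribution_moments[OF \<rho>', folded S_def] y y'(2) K(2) R
    have b: "?b \<in> diag_upper_half_plane" using y by (simp add: diag_upper_half_plane_def mat_mat2)
    then have \<Omega>b: "\<Omega> ?b \<in> diag_upper_half_plane"
      and eq: "map_matrix \<tau> (matrix_inv (map_matrix scalar (?b + mat2 0 lam (cnj lam) 0) - mat2 0 T (adj T) 0))
        = matrix_inv (\<Omega> ?b + mat2 0 lam (cnj lam) 0)"
      using sub unfolding operator_subordination_def by blast+
    have w: "?w \<in> upper_half_plane"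
      using \<Omega>b by (simp add: diag_upper_half_plane_def upper_half_plane_def)
    note entries = subordination_entries[OF \<Omega>b eq[unfolded M.hermitization_resolvent[OF M(2) S_def y
          M.shifted_resolvent_in[OF res] R]]]
    have "cauchy_transform (symmetrization \<rho>') (\<i> * complex_of_real y) = - \<i> * complex_of_real y * \<tau> R"
      unfolding M.shifted_resolvent_state[OF res] cauchy_transform_symmetrization_imaginary[OF K(1) y]
      by (simp only: of_real_mult mult.assoc)
    moreover have "cmod (lam / (?w\<^sup>2 - (complex_of_real (cmod lam))\<^sup>2)) \<le> sqrt (Re (\<tau> (S * adj S))) / y\<^sup>2"
      using M.shifted_resolvent_offdiag[OF res] entries(2) by simp
    ultimately show "cauchy_transform (symmetrization \<rho>') (\<i> * complex_of_real y) =
        cauchy_transform (two_point (cmod lam)) ?w \<and>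
      cmod (lam / (?w\<^sup>2 - (complex_of_real (cmod lam))\<^sup>2)) \<le> sqrt (Re (\<tau> (S * adj S))) / y\<^sup>2"
      unfolding cauchy_transform_two_point[OF w] using entries(1) by simp
  qed
qed

lemma operator_subordination_eq:
  fixes \<Omega> :: "complex ^ 2 ^ 2 \<Rightarrow> complex ^ 2 ^ 2"
  assumes M: "tracial_vn_algebra M \<tau>" "T \<in> M" and sub: "operator_subordination \<tau> T lam \<Omega>"
    and \<rho>': "modulus_distribution \<tau> (T - scalar lam) \<rho>'" and lam: "lam \<noteq> 0"
    and hol: "\<omega> holomorphic_on upper_half_plane"
    and half_plane: "\<And>z. z \<in> upper_half_plane \<Longrightarrow> \<omega> z \<in> upper_half_plane"
    and Im_ge: "\<And>z. z \<in> upper_half_plane \<Longrightarrow> Im z \<le> Im (\<omega> z)"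
    and transform: "\<And>z. z \<in> upper_half_plane \<Longrightarrow>
      cauchy_transform (symmetrization \<rho>') z = cauchy_transform (two_point (cmod lam)) (\<omega> z)"
    and z: "z \<in> upper_half_plane"
  shows "\<Omega> (mat z) $ 1 $ 1 = \<omega> z"
proof -
  let ?r = "cmod lam" and ?w = "\<lambda>z. \<Omega> (mat z) $ 1 $ 1"
  obtain Y C where YC: "\<And>y. Y < y \<Longrightarrow> 0 < y \<Longrightarrow>
      cauchy_transform (symmetrization \<rho>') (\<i> * complex_of_real y) =
        cauchy_transform (two_point ?r) (?w (\<i> * complex_of_real y)) \<and>
      cmod (lam / ((?w (\<i> * complex_of_real y))\<^sup>2 - (complex_of_real ?r)\<^sup>2)) \<le> C / y\<^sup>2"
    using operator_subordination_resolvent[OF M sub \<rho>'] by blast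
  have w_hol: "?w holomorphic_on upper_half_plane"
    using sub by (intro diag_analytic_holomorphic) (simp add: operator_subordination_def)
  have "?w (\<i> * complex_of_real y) = \<omega> (\<i> * complex_of_real y)"
    if y: "max (max Y 1) (max ?r (2 * ?r * C)) < y" for y
  proof -
    let ?z = "\<i> * complex_of_real y"
    have y': "Y < y" "0 < y" "1 < y" "?r < y" "2 * ?r * C < y" using y by auto
    have z: "?z \<in> upper_half_plane" using y' by (simp add: upper_half_plane_def)
    then have "mat ?z \<in> diag_upper_half_plane"
      by (simp add: diag_upper_half_plane_def upper_half_plane_def mat_mat2)
    then have w: "?w ?z \<in> upper_half_plane"
      using sub unfolding operator_subordination_def by (auto simp: diag_upper_half_plane_def upper_half_plane_def)
    have o: "\<omega> ?z \<in> upper_half_plane" using half_plane[OF z] .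
    have "?w ?z / ((?w ?z)\<^sup>2 - (complex_of_real ?r)\<^sup>2) = \<omega> ?z / ((\<omega> ?z)\<^sup>2 - (complex_of_real ?r)\<^sup>2)"
      using YC[OF y'(1,2)] transform[OF z]
      by (simp only: cauchy_transform_two_point[OF w] cauchy_transform_two_point[OF o])
    then consider "?w ?z = \<omega> ?z" | "?w ?z * \<omega> ?z = - (complex_of_real ?r)\<^sup>2"
      using two_point_transform_eq[OF w o] by blast
    then show ?thesis
    proof cases
      case 2
      have "cmod (?w ?z) * cmod (\<omega> ?z) = ?r\<^sup>2"
        using arg_cong[OF 2, of cmod] by (simp add: norm_mult norm_power)
      moreover have "?r \<le> cmod (\<omega> ?z)"
        using Im_ge[OF z] y' abs_Im_le_cmod[of "\<omega> ?z"] by simp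
      ultimately have "cmod (?w ?z) * ?r \<le> ?r * ?r"
        using mult_left_mono[of ?r "cmod (\<omega> ?z)" "cmod (?w ?z)"] by (simp add: power2_eq_square)
      then have "cmod (?w ?z) \<le> ?r" using lam by simp
      then have "(cmod (?w ?z))\<^sup>2 \<le> ?r\<^sup>2" by (intro power_mono) auto
      moreover have "cmod ((?w ?z)\<^sup>2 - (complex_of_real ?r)\<^sup>2) \<le> (cmod (?w ?z))\<^sup>2 + ?r\<^sup>2"
        using norm_triangle_ineq4[of "(?w ?z)\<^sup>2" "(complex_of_real ?r)\<^sup>2"] by (simp add: norm_power)
      ultimately have small: "cmod ((?w ?z)\<^sup>2 - (complex_of_real ?r)\<^sup>2) \<le> 2 * ?r\<^sup>2"
        by linarith
      have ne: "(?w ?z)\<^sup>2 - (complex_of_real ?r)\<^sup>2 \<noteq> 0" using upper_half_plane_square_ne(2)[OF w, of ?r] by simp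
      have bound: "cmod (lam / ((?w ?z)\<^sup>2 - (complex_of_real ?r)\<^sup>2)) \<le> C / y\<^sup>2" using YC[OF y'(1,2)] by blast
      have "?r = cmod (lam / ((?w ?z)\<^sup>2 - (complex_of_real ?r)\<^sup>2)) * cmod ((?w ?z)\<^sup>2 - (complex_of_real ?r)\<^sup>2)"
        using ne by (simp add: norm_divide)
      also have "\<dots> \<le> C / y\<^sup>2 * (2 * ?r\<^sup>2)"
        using bound small by (intro mult_mono) (auto intro: order_trans[OF norm_ge_zero])
      finally have "?r * y\<^sup>2 \<le> ?r * (2 * ?r * C)"
        using y' by (simp add: field_simps power2_eq_square)
      then have "y\<^sup>2 \<le> 2 * ?r * C" using lam by simp
      moreover have "y \<le> y\<^sup>2" using y' by (simp add: power2_eq_square)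
      ultimately show ?thesis using y' by linarith
    qed
  qed
  then show ?thesis
    by (rule upper_half_plane_identity[OF w_hol hol _ z])
qed

theorem proposition6p1:
  fixes M :: "('h::chilbert_space) bop set" and \<tau> :: "'h bop \<Rightarrow> complex" and T :: "'h bop"
    and lam :: complex and \<epsilon> :: real and \<delta> :: complex
    and \<Omega>\<^sub>2 :: "complex ^ 2 ^ 2 \<Rightarrow> complex ^ 2 ^ 2"
    and \<rho> \<rho>' \<mu> \<nu> \<sigma> :: "real measure"
    and \<omega>\<^sub>1 \<omega>\<^sub>2 :: "complex \<Rightarrow> complex"
  assumes "tracial_vn_algebra M \<tau>"
    and "T \<in> M"
    and "R_diagonal TYPE('k::chilbert_space) \<tau> T"
    and "lam \<noteq> 0"
    and "\<epsilon> > 0"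
    and "operator_subordination \<tau> T lam \<Omega>\<^sub>2"
    and "\<Omega>\<^sub>2 (mat (\<i> * complex_of_real \<epsilon>)) = mat (\<i> * \<delta>)"
    and "modulus_distribution \<tau> T \<rho>"
    and "modulus_distribution \<tau> (T - scalar lam) \<rho>'"
    and "\<mu> = symmetrization \<rho>"
    and "\<nu> = two_point (cmod lam)"
    and "free_additive_convolution TYPE('l::chilbert_space) \<mu> \<nu> \<sigma>"
    and "scalar_subordination \<mu> \<nu> \<sigma> \<omega>\<^sub>1 \<omega>\<^sub>2"
  shows "(\<forall>z\<in>upper_half_plane.
            cauchy_transform (symmetrization \<rho>') z = cauchy_transform \<nu> (\<omega>\<^sub>2 z)) \<and>
         \<i> * \<delta> = \<omega>\<^sub>2 (\<i> * complex_of_real \<epsilon>) \<and>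
         \<delta> \<in> \<real> \<and> 0 < Re \<delta> \<and>
         \<delta> = complex_of_real (Im (\<omega>\<^sub>2 (\<i> * complex_of_real \<epsilon>))) \<and>
         Im (\<omega>\<^sub>2 (\<i> * complex_of_real \<epsilon>)) =
           (cmod lam)\<^sup>2 / (Im (\<omega>\<^sub>1 (\<i> * complex_of_real \<epsilon>)) - \<epsilon>)"
proof -
  let ?i\<epsilon> = "\<i> * complex_of_real \<epsilon>" and ?r = "cmod lam"
  have i\<epsilon>: "?i\<epsilon> \<in> upper_half_plane" using assms(5) by (simp add: upper_half_plane_def)
  note sub = assms(13)[unfolded assms(11)]
  have hol: "\<omega>\<^sub>2 holomorphic_on upper_half_plane"
    using sub unfolding scalar_subordination_def by blast
  have half_plane: "\<omega>\<^sub>2 z \<in> upper_half_plane"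
    and F: "F_transform (two_point ?r) (\<omega>\<^sub>2 z) = F_transform \<sigma> z"
    and sum: "\<omega>\<^sub>1 z + \<omega>\<^sub>2 z = z + F_transform \<sigma> z" if "z \<in> upper_half_plane" for z
    using sub that unfolding scalar_subordination_def by blast+
  obtain K where K: "supported \<rho> K" using modulus_distribution_supported[OF assms(8)] by blast
  have "real_distribution \<mu>"
    using supported_symmetrization[OF K] by (simp add: assms(10) supported_def)
  then have Im_ge: "Im z \<le> Im (\<omega>\<^sub>2 z)" if "z \<in> upper_half_plane" for z
    using subordination_Im_ge[OF sub] that by blast
  have transform: "cauchy_transform (symmetrization \<rho>') z = cauchy_transform (two_point ?r) (\<omega>\<^sub>2 z)"
    if "z \<in> upper_half_plane" for z
  proof -
    have "cauchy_transform (symmetrization \<rho>') z = cauchy_transform \<sigma> z"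
      using that assms(12) unfolding assms(10,11)
      by (intro shifted_convolution_transform[OF assms(1-3,8,9)]) (auto simp: upper_half_plane_def)
    then show ?thesis using F[OF that] by (simp add: F_transform_def)
  qed
  obtain K' where K': "supported \<rho>' K'" using modulus_distribution_supported[OF assms(9)] by blast
  have "\<exists>t. cauchy_transform (two_point ?r) (\<omega>\<^sub>2 (\<i> * complex_of_real y)) = \<i> * complex_of_real t"
    if "0 < y" for y
  proof -
    have "cauchy_transform (two_point ?r) (\<omega>\<^sub>2 (\<i> * complex_of_real y))
        = \<i> * complex_of_real (- (y * (\<integral>x. 1 / (y\<^sup>2 + x\<^sup>2) \<partial>\<rho>')))"
      using transform[of "\<i> * complex_of_real y"] that
      unfolding cauchy_transform_symmetrization_imaginary[OF K' that]
      by (simp add: upper_half_plane_def)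
    then show ?thesis by blast
  qed
  then have Re0: "Re (\<omega>\<^sub>2 ?i\<epsilon>) = 0"
    using two_point_subordination_symmetric[OF hol half_plane Im_ge _ assms(5)] by blast
  define t where "t = Im (\<omega>\<^sub>2 ?i\<epsilon>)"
  have t: "0 < t" using half_plane[OF i\<epsilon>] by (simp add: t_def upper_half_plane_def)
  have \<omega>t: "\<omega>\<^sub>2 ?i\<epsilon> = \<i> * complex_of_real t" using Re0 by (simp add: complex_eq_iff t_def)
  have \<Omega>: "\<Omega>\<^sub>2 (mat ?i\<epsilon>) $ 1 $ 1 = \<omega>\<^sub>2 ?i\<epsilon>"
    by (rule operator_subordination_eq[OF assms(1,2,6,9,4) hol half_plane Im_ge transform i\<epsilon>])
  have \<delta>: "\<i> * \<delta> = \<omega>\<^sub>2 ?i\<epsilon>"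
    unfolding \<Omega>[symmetric] assms(7) unfolding mat_mat2 by simp
  then have \<delta>t: "\<delta> = complex_of_real t" by (simp add: \<omega>t)
  have "F_transform \<sigma> ?i\<epsilon> = \<i> * complex_of_real (t + ?r\<^sup>2 / t)"
  proof -
    have "F_transform \<sigma> ?i\<epsilon> = ((\<i> * complex_of_real t)\<^sup>2 - (complex_of_real ?r)\<^sup>2) / (\<i> * complex_of_real t)"
      using F[OF i\<epsilon>] cauchy_transform_two_point[OF half_plane[OF i\<epsilon>], of ?r] by (simp add: F_transform_def \<omega>t)
    also have "\<dots> = \<i> * complex_of_real (t + ?r\<^sup>2 / t)"
      using t by (simp add: field_simps power2_eq_square)
    finally show ?thesis .
  qed
  then have "Im (\<omega>\<^sub>1 ?i\<epsilon>) + t = \<epsilon> + (t + ?r\<^sup>2 / t)"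
    using arg_cong[OF sum[OF i\<epsilon>], of Im] by (simp add: \<omega>t)
  then have "Im (\<omega>\<^sub>1 ?i\<epsilon>) - \<epsilon> = ?r\<^sup>2 / t" by simp
  then have "t = ?r\<^sup>2 / (Im (\<omega>\<^sub>1 ?i\<epsilon>) - \<epsilon>)" using t assms(4) by simp
  then show ?thesis
    using transform \<delta> \<delta>t t \<omega>t unfolding assms(11) t_def[symmetric] by simp
qed

end
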